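(* Let $\mathbb{K}$ be a field and let $p,q,\lambda,\mu\in\mathbb{K}^{\ast}$. If neither $p$ nor $q$ is a root of unity, then the localization $(\mathcal{A}_p(\lambda,\mu,\mathbb{K}_q[s,t]))_{\mathbb{S}}$ is a simple algebra.
   Context: For a field $\mathbb{K}$ and $p,q,\lambda,\mu\in\mathbb{K}^{\ast}$, $\mathcal{A}_p(\lambda,\mu,\mathbb{K}_q[s,t])$ denotes the associative unital $\mathbb{K}$-algebra generated by $x,y,s,t$ subject to the relations $$xy-pyx=1,\quad st=qts,\quad sx=\lambda xs,\quad sy=\lambda^{-1}ys,\quad tx=\mu xt,\quad ty=\mu^{-1}yt.$$ Put $z:=xy-yx$. Then $xz=pzx$, $yz=p^{-1}zy$, $sz=zs$, $tz=zt$. The set $\mathbb{S}=\{z^is^jt^k\mid i,j,k\in\mathbb{Z}_{\ge 0}\}$ generates (up to nonzero scalars) an Ore set of normal elements, and the subscript $\mathbb{S}$ denotes localization at it, i.e. $z,s,t$ are inverted. The number $1$ counts as a root of unity. *)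

theory Defs
  imports "HOL-Algebra.Algebra" "HOL-Algebra.Algebraic_Closure_Type" "HOL-Library.Poly_Mapping"
begin

section \<open>Free algebras\<close>

datatype 'g word = Word "'g list"

instantiation word :: (type) monoid_add
begin

definition zero_word :: "'g word" where
  "zero_word = Word []"

fun plus_word :: "'g word \<Rightarrow> 'g word \<Rightarrow> 'g word" where
  "plus_word (Word u) (Word v) = Word (u @ v)"

instance
proof
  fix a b c :: "'g word"
  show "a + b + c = a + (b + c)" by (cases a; cases b; cases c) simp
  show "0 + a = a" by (cases a) (simp add: zero_word_def)
  show "a + 0 = a" by (cases a) (simp add: zero_word_def)
qed

end

text \<open>The monoid algebra of the free monoid: multiplication on \<^typ>\<open>'g word \<Rightarrow>\<^sub>0 'k\<close> is convolution
  along concatenation of words, so the variables do not commute with each other, but they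
  commute with the scalars.\<close>

type_synonym ('g, 'k) free_algebra = "'g word \<Rightarrow>\<^sub>0 'k"

abbreviation Free :: "('g, 'k::field) free_algebra ring" where
  "Free \<equiv> ring_of_type_algebra"

definition fvar :: "'g \<Rightarrow> ('g, 'k::field) free_algebra" where
  "fvar g = Poly_Mapping.single (Word [g]) 1"

definition scal :: "'k \<Rightarrow> ('g, 'k::field) free_algebra" where
  "scal c = Poly_Mapping.single 0 c"

lemma ring_Free: "ring (Free :: ('g, 'k::field) free_algebra ring)"
proof -
  have "\<exists>y. x + y = 0" for x :: "('g, 'k) free_algebra"
    using add.right_inverse by blast
  thus ?thesis
    unfolding ring_of_type_algebra_def using add.right_inverse
    by unfold_locales (auto simp: algebra_simps Units_def)
qed


section \<open>The algebra \<open>A\<^sub>p(\<lambda>, \<mu>, K\<^sub>q[s,t])\<close>\<close>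

datatype gen = Gx | Gy | Gs | Gt

abbreviation "Fx \<equiv> fvar Gx"
abbreviation "Fy \<equiv> fvar Gy"
abbreviation "Fs \<equiv> fvar Gs"
abbreviation "Ft \<equiv> fvar Gt"

definition weyl_rels :: "'k::field \<Rightarrow> 'k \<Rightarrow> 'k \<Rightarrow> 'k \<Rightarrow> (gen, 'k) free_algebra set" where
  "weyl_rels p q lam mu =
    {Fx * Fy - scal p * Fy * Fx - 1,
     Fs * Ft - scal q * Ft * Fs,
     Fs * Fx - scal lam * Fx * Fs,
     Fs * Fy - scal (inverse lam) * Fy * Fs,
     Ft * Fx - scal mu * Fx * Ft,
     Ft * Fy - scal (inverse mu) * Fy * Ft}"

definition weyl_ideal :: "'k::field \<Rightarrow> 'k \<Rightarrow> 'k \<Rightarrow> 'k \<Rightarrow> (gen, 'k) free_algebra set" where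
  "weyl_ideal p q lam mu = genideal Free (weyl_rels p q lam mu)"

definition weyl_alg :: "'k::field \<Rightarrow> 'k \<Rightarrow> 'k \<Rightarrow> 'k \<Rightarrow> (gen, 'k) free_algebra set ring" where
  "weyl_alg p q lam mu = Free Quot weyl_ideal p q lam mu"

definition weyl_class ::
  "'k::field \<Rightarrow> 'k \<Rightarrow> 'k \<Rightarrow> 'k \<Rightarrow> (gen, 'k) free_algebra \<Rightarrow> (gen, 'k) free_algebra set" where
  "weyl_class p q lam mu f = weyl_ideal p q lam mu +>\<^bsub>Free\<^esub> f"

lemma ideal_weyl_ideal: "ideal (weyl_ideal p q lam mu) Free"
  unfolding weyl_ideal_def
  by (rule ring.genideal_ideal[OF ring_Free]) (simp add: ring_of_type_algebra_def)

lemma ring_weyl_alg: "ring (weyl_alg p q lam mu)"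
  unfolding weyl_alg_def by (rule ideal.quotient_is_ring[OF ideal_weyl_ideal])

definition Fz :: "(gen, 'k::field) free_algebra" where
  "Fz = Fx * Fy - Fy * Fx"

text \<open>The monomials \<open>z\<^sup>i s\<^sup>j t\<^sup>k\<close> themselves are not closed under multiplication
  (\<open>t s = q\<^sup>-\<^sup>1 s t\<close>); their nonzero scalar multiples are.\<close>

definition weyl_ore_set ::
  "'k::field \<Rightarrow> 'k \<Rightarrow> 'k \<Rightarrow> 'k \<Rightarrow> (gen, 'k) free_algebra set set" where
  "weyl_ore_set p q lam mu =
    {weyl_class p q lam mu (scal c * Fz ^ i * Fs ^ j * Ft ^ k) | c i j k. c \<noteq> 0}"


section \<open>Ore localization\<close>

text \<open>Left fractions: the pair \<open>(s, a)\<close> stands for \<open>s\<^sup>-\<^sup>1 a\<close>. Two fractions are identified when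
  they can be expanded to a common denominator with equal numerators. The definitions make
  sense for arbitrary \<open>S\<close> and yield a ring when \<open>S\<close> is a left denominator set.\<close>

definition lfrac_rel :: "('a, 'm) ring_scheme \<Rightarrow> 'a set \<Rightarrow> (('a \<times> 'a) \<times> ('a \<times> 'a)) set" where
  "lfrac_rel R S = {((s, a), (t, b)).
     s \<in> S \<and> t \<in> S \<and> a \<in> carrier R \<and> b \<in> carrier R \<and>
     (\<exists>u \<in> carrier R. \<exists>v \<in> carrier R. u \<otimes>\<^bsub>R\<^esub> s \<in> S \<and>
        u \<otimes>\<^bsub>R\<^esub> s = v \<otimes>\<^bsub>R\<^esub> t \<and> u \<otimes>\<^bsub>R\<^esub> a = v \<otimes>\<^bsub>R\<^esub> b)}"

definition lfrac :: "('a, 'm) ring_scheme \<Rightarrow> 'a set \<Rightarrow> 'a \<Rightarrow> 'a \<Rightarrow> ('a \<times> 'a) set" where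
  "lfrac R S s a = lfrac_rel R S `` {(s, a)}"

text \<open>As for cosets in \<^const>\<open>rcoset_mult\<close>, the operations on classes are unions over all
  representatives, and here also over all choices in the Ore condition:
  \<open>(s\<^sup>-\<^sup>1 a)(t\<^sup>-\<^sup>1 b) = (u s)\<^sup>-\<^sup>1 (c b)\<close> whenever \<open>u a = c t\<close> with \<open>u \<in> S\<close>, and
  \<open>s\<^sup>-\<^sup>1 a + t\<^sup>-\<^sup>1 b = (u s)\<^sup>-\<^sup>1 (u a + v b)\<close> whenever \<open>u s = v t \<in> S\<close>.\<close>

definition lfrac_mult ::
  "('a, 'm) ring_scheme \<Rightarrow> 'a set \<Rightarrow> ('a \<times> 'a) set \<Rightarrow> ('a \<times> 'a) set \<Rightarrow> ('a \<times> 'a) set" where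
  "lfrac_mult R S A B =
    \<Union> {lfrac R S (u \<otimes>\<^bsub>R\<^esub> s) (c \<otimes>\<^bsub>R\<^esub> b) | s a t b u c.
         (s, a) \<in> A \<and> (t, b) \<in> B \<and> u \<in> S \<and> c \<in> carrier R \<and> u \<otimes>\<^bsub>R\<^esub> a = c \<otimes>\<^bsub>R\<^esub> t}"

definition lfrac_add ::
  "('a, 'm) ring_scheme \<Rightarrow> 'a set \<Rightarrow> ('a \<times> 'a) set \<Rightarrow> ('a \<times> 'a) set \<Rightarrow> ('a \<times> 'a) set" where
  "lfrac_add R S A B =
    \<Union> {lfrac R S (u \<otimes>\<^bsub>R\<^esub> s) (u \<otimes>\<^bsub>R\<^esub> a \<oplus>\<^bsub>R\<^esub> v \<otimes>\<^bsub>R\<^esub> b) | s a t b u v.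
         (s, a) \<in> A \<and> (t, b) \<in> B \<and> u \<in> carrier R \<and> v \<in> carrier R \<and>
         u \<otimes>\<^bsub>R\<^esub> s \<in> S \<and> u \<otimes>\<^bsub>R\<^esub> s = v \<otimes>\<^bsub>R\<^esub> t}"

definition ore_localization :: "('a, 'm) ring_scheme \<Rightarrow> 'a set \<Rightarrow> ('a \<times> 'a) set ring" where
  "ore_localization R S =
    \<lparr>carrier = (S \<times> carrier R) // lfrac_rel R S,
     monoid.mult = lfrac_mult R S, one = lfrac R S \<one>\<^bsub>R\<^esub> \<one>\<^bsub>R\<^esub>,
     ring.zero = lfrac R S \<one>\<^bsub>R\<^esub> \<zero>\<^bsub>R\<^esub>, add = lfrac_add R S\<rparr>"

definition weyl_localization ::
  "'k::field \<Rightarrow> 'k \<Rightarrow> 'k \<Rightarrow> 'k \<Rightarrow>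
     ((gen, 'k) free_algebra set \<times> (gen, 'k) free_algebra set) set ring" where
  "weyl_localization p q lam mu = ore_localization (weyl_alg p q lam mu) (weyl_ore_set p q lam mu)"

definition weyl_localization_scal ::
  "'k::field \<Rightarrow> 'k \<Rightarrow> 'k \<Rightarrow> 'k \<Rightarrow> 'k \<Rightarrow>
     ((gen, 'k) free_algebra set \<times> (gen, 'k) free_algebra set) set" where
  "weyl_localization_scal p q lam mu c =
    lfrac (weyl_alg p q lam mu) (weyl_ore_set p q lam mu)
      \<one>\<^bsub>weyl_alg p q lam mu\<^esub> (weyl_class p q lam mu (scal c))"


section \<open>Simple algebras and roots of unity\<close>

text \<open>A unital associative algebra over the field \<^typ>\<open>'k\<close>, given by its structure map into the
  centre. The locale \<^locale>\<open>algebra\<close> of HOL-Algebra only covers commutative algebras.\<close>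

definition assoc_algebra :: "('k::field \<Rightarrow> 'a) \<Rightarrow> ('a, 'm) ring_scheme \<Rightarrow> bool" where
  "assoc_algebra h R \<longleftrightarrow> ring R \<and> h \<in> ring_hom (ring_of_type_algebra :: 'k ring) R \<and>
     (\<forall>c. \<forall>a \<in> carrier R. h c \<otimes>\<^bsub>R\<^esub> a = a \<otimes>\<^bsub>R\<^esub> h c)"

text \<open>In a unital algebra every two-sided ring ideal is closed under scalars, so ring ideals and
  algebra ideals coincide. (The locale \<^locale>\<open>ideal\<close> is two-sided.)\<close>

definition simple_algebra :: "('k::field \<Rightarrow> 'a) \<Rightarrow> ('a, 'm) ring_scheme \<Rightarrow> bool" where
  "simple_algebra h R \<longleftrightarrow> assoc_algebra h R \<and> \<one>\<^bsub>R\<^esub> \<noteq> \<zero>\<^bsub>R\<^esub> \<and>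
     (\<forall>I. ideal I R \<longrightarrow> I = {\<zero>\<^bsub>R\<^esub>} \<or> I = carrier R)"

definition root_of_unity :: "'k::field \<Rightarrow> bool" where
  "root_of_unity c \<longleftrightarrow> (\<exists>n>0. c ^ n = 1)"

end

theory Submission
  imports Defs
begin

text \<open>
  The elements \<open>z\<close>, \<open>s\<close>, \<open>t\<close> become units in the localization, and both \<open>y x\<close> and \<open>x y\<close> are polynomials
  of degree one in \<open>z\<close>. Hence every element of the algebra is a linear combination of monomials
  \<open>z\<^sup>i X\<^sup>d s\<^sup>j t\<^sup>k\<close>, where \<open>d\<close> is an integer and \<open>X\<^sup>d\<close> means \<open>x\<^sup>d\<close> for \<open>d \<ge> 0\<close> and \<open>y\<close> to the power \<open>-d\<close>
  otherwise (\<open>spanned_all\<close>). Such a monomial commutes with \<open>z\<close>, \<open>s\<close> and \<open>t\<close> up to the scalars \<open>p\<close> to the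
  power \<open>-d\<close>, \<open>\<lambda>\<^sup>d q\<^sup>k\<close> and \<open>\<mu>\<^sup>d\<close> times \<open>q\<close> to the power \<open>-j\<close>. Since \<open>p\<close> and \<open>q\<close> are not roots of
  unity, these three scalars determine \<open>d\<close>, \<open>k\<close> and \<open>j\<close>.

  A nonzero ideal of the localization is described by the ideal \<open>J\<close> of those elements of the algebra
  that it contains, and \<open>J\<close> admits cancellation of \<open>z\<close>, \<open>s\<close>, \<open>t\<close>. Conjugation by \<open>z\<close>, \<open>s\<close>, \<open>t\<close> thus acts on
  \<open>J\<close>, so \<open>J\<close> contains the joint eigencomponents of its elements (\<open>eigencomponent_in_J\<close>), in particular
  some \<open>f(z) X\<^sup>d\<close> with a polynomial \<open>f \<noteq> 0\<close>. Because \<open>x z\<^sup>i = p\<^sup>i z\<^sup>i x\<close>, a commutator with \<open>x\<close> (with \<open>y\<close> if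
  \<open>d < 0\<close>) deletes one term of \<open>f\<close> and multiplies the others by a further \<open>x\<close> (or \<open>y\<close>), so \<open>J\<close> contains
  a power of \<open>x\<close> or of \<open>y\<close> (\<open>power_in_J\<close>). Finally
  \<open>x\<^sup>n y - p\<^sup>n y x\<^sup>n = (1 + p + \<dots> + p\<^bsup>n-1\<^esup>) x\<^bsup>n-1\<^esup>\<close>, with a nonzero coefficient, lowers that power down
  to \<open>1\<close> (\<open>one_in_J_of_power\<close>).

  That the localization is a ring is the general theory of left fractions. The denominators satisfy
  its hypotheses because they are normal: moving one of them past an element rescales the variables,
  and this rescaling respects the relations and multiplies each denominator by a
  scalar (\<open>normal_twist\<close>, \<open>smono_reversible\<close>). The localization is nonzero because
  the algebra acts on functions on pairs of natural numbers in such a way that \<open>z\<close>, \<open>s\<close>, \<open>t\<close> preserve the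
  functions without zeros (\<open>smono_notin_W\<close>).
\<close>

section \<open>Rings of left fractions\<close>

text \<open>Moving a fraction past a denominator is possible by \<open>ore\<close>; \<open>reversible\<close> turns right cancellation
  of a denominator into left cancellation of another one, which is what left fractions can absorb.\<close>

locale left_denominator_set = ring R for R (structure) +
  fixes S
  assumes sub: "S \<subseteq> carrier R"
    and one_in: "\<one> \<in> S"
    and mult_in: "\<lbrakk>s \<in> S; t \<in> S\<rbrakk> \<Longrightarrow> s \<otimes> t \<in> S"
    and ore: "\<lbrakk>a \<in> carrier R; s \<in> S\<rbrakk> \<Longrightarrow> \<exists>u\<in>S. \<exists>c\<in>carrier R. u \<otimes> a = c \<otimes> s"
    and reversible: "\<lbrakk>a \<in> carrier R; s \<in> S; a \<otimes> s = \<zero>\<rbrakk> \<Longrightarrow> \<exists>u\<in>S. u \<otimes> a = \<zero>"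
begin

abbreviation "fraction \<equiv> lfrac R S"
abbreviation "Loc \<equiv> ore_localization R S"

lemma in_carrier: "s \<in> S \<Longrightarrow> s \<in> carrier R"
  using sub by blast

lemma cancel_right:
  assumes "u \<in> carrier R" "v \<in> carrier R" "t \<in> S" "u \<otimes> t = v \<otimes> t"
  shows "\<exists>e\<in>S. e \<otimes> u = e \<otimes> v"
proof -
  have t: "t \<in> carrier R" using assms(3) in_carrier by blast
  have "(u \<ominus> v) \<otimes> t = \<zero>"
    using assms t by (simp add: minus_eq l_distr l_minus r_neg)
  then obtain e where e: "e \<in> S" "e \<otimes> (u \<ominus> v) = \<zero>"
    using reversible[of "u \<ominus> v" t] assms by auto
  have "e \<otimes> u = e \<otimes> v"
    using e assms in_carrier[OF e(1)]
    by (metis m_closed minus_closed minus_eq r_distr r_minus a_inv_closed r_right_minus_eq)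
  thus ?thesis using e by blast
qed

text \<open>The two denominators \<open>u s\<close> and \<open>v s\<close> have a common left multiple by the Ore condition, and the
  factor \<open>s\<close> can then be cancelled at the price of a further denominator on the left.\<close>

lemma equalise:
  assumes "u \<in> carrier R" "v \<in> carrier R" "s \<in> S" "u \<otimes> s \<in> S" "v \<otimes> s \<in> S"
  shows "\<exists>w\<in>S. \<exists>w'\<in>carrier R. w \<otimes> u = w' \<otimes> v"
proof -
  have s: "s \<in> carrier R" using assms in_carrier by blast
  obtain w w' where w: "w \<in> S" "w' \<in> carrier R" "w \<otimes> (u \<otimes> s) = w' \<otimes> (v \<otimes> s)"
    using ore[of "u \<otimes> s" "v \<otimes> s"] assms in_carrier by blast
  have wc: "w \<in> carrier R" using w in_carrier by blast
  have "(w \<otimes> u) \<otimes> s = (w' \<otimes> v) \<otimes> s" using w wc s assms by (simp add: m_assoc)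
  then obtain e where e: "e \<in> S" "e \<otimes> (w \<otimes> u) = e \<otimes> (w' \<otimes> v)"
    using cancel_right[of "w \<otimes> u" "w' \<otimes> v" s] wc w assms by auto
  have "e \<in> carrier R" using e in_carrier by blast
  with e have "(e \<otimes> w) \<otimes> u = (e \<otimes> w') \<otimes> v" using wc w assms by (simp add: m_assoc)
  thus ?thesis using mult_in[OF e(1) w(1)] w \<open>e \<in> carrier R\<close> by blast
qed

lemma rel_iff:
  "((s, a), (t, b)) \<in> lfrac_rel R S \<longleftrightarrow> s \<in> S \<and> t \<in> S \<and> a \<in> carrier R \<and> b \<in> carrier R \<and>
     (\<exists>u\<in>carrier R. \<exists>v\<in>carrier R. u \<otimes> s \<in> S \<and> u \<otimes> s = v \<otimes> t \<and> u \<otimes> a = v \<otimes> b)"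
  by (simp add: lfrac_rel_def)

lemma equiv_rel: "equiv (S \<times> carrier R) (lfrac_rel R S)"
proof (rule equivI)
  show "lfrac_rel R S \<subseteq> (S \<times> carrier R) \<times> (S \<times> carrier R)"
    by (auto simp: lfrac_rel_def)
  show "refl_on (S \<times> carrier R) (lfrac_rel R S)"
  proof (rule refl_onI)
    fix P assume "P \<in> S \<times> carrier R"
    then obtain s a where P: "P = (s, a)" "s \<in> S" "a \<in> carrier R" by auto
    show "(P, P) \<in> lfrac_rel R S"
      unfolding P(1) rel_iff using P in_carrier[of s] by (intro conjI bexI[of _ "\<one>"]) auto
  qed
  show "sym (lfrac_rel R S)"
  proof (rule symI)
    fix P Q assume "(P, Q) \<in> lfrac_rel R S"
    moreover obtain s a where "P = (s, a)" by fastforce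
    moreover obtain t b where "Q = (t, b)" by fastforce
    ultimately show "(Q, P) \<in> lfrac_rel R S" by (simp add: rel_iff) metis
  qed
  show "trans (lfrac_rel R S)"
  proof (rule transI)
    fix P Q T assume PQ: "(P, Q) \<in> lfrac_rel R S" and QT: "(Q, T) \<in> lfrac_rel R S"
    obtain s a where P: "P = (s, a)" by fastforce
    obtain t b where Q: "Q = (t, b)" by fastforce
    obtain r c where T: "T = (r, c)" by fastforce
    note PQ = PQ[unfolded P Q rel_iff] and QT = QT[unfolded Q T rel_iff]
    obtain u v where u: "u \<in> carrier R" "v \<in> carrier R" "u \<otimes> s \<in> S" "u \<otimes> s = v \<otimes> t" "u \<otimes> a = v \<otimes> b"
      using PQ by blast
    obtain u' v' where u': "u' \<in> carrier R" "v' \<in> carrier R" "u' \<otimes> t \<in> S" "u' \<otimes> t = v' \<otimes> r"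
      "u' \<otimes> b = v' \<otimes> c"
      using QT by blast
    have S: "s \<in> S" "t \<in> S" "r \<in> S" "a \<in> carrier R" "b \<in> carrier R" "c \<in> carrier R"
      using PQ QT by auto
    note C = S(1-3)[THEN in_carrier]
    obtain w w' where w: "w \<in> S" "w' \<in> carrier R" "w \<otimes> v = w' \<otimes> u'"
      using equalise[of v u' t] u u' S by auto
    have wc: "w \<in> carrier R" using w in_carrier by blast
    have 1: "(w \<otimes> u) \<otimes> s = (w' \<otimes> v') \<otimes> r"
    proof -
      have "(w \<otimes> u) \<otimes> s = (w \<otimes> v) \<otimes> t" using u wc C by (simp add: m_assoc)
      also have "\<dots> = w' \<otimes> (u' \<otimes> t)" using w u' C by (simp add: m_assoc)
      finally show ?thesis using w u' C by (simp add: m_assoc)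
    qed
    have 2: "(w \<otimes> u) \<otimes> a = (w' \<otimes> v') \<otimes> c"
    proof -
      have "(w \<otimes> u) \<otimes> a = (w \<otimes> v) \<otimes> b" using u wc S by (simp add: m_assoc)
      also have "\<dots> = w' \<otimes> (u' \<otimes> b)" using w u' S by (simp add: m_assoc)
      finally show ?thesis using w u' S by (simp add: m_assoc)
    qed
    have 3: "(w \<otimes> u) \<otimes> s \<in> S"
      using mult_in[OF w(1) u(3)] wc u C by (simp add: m_assoc)
    show "(P, T) \<in> lfrac_rel R S"
      unfolding P T rel_iff using S wc u w u' 1 2 3
      by (intro conjI bexI[of _ "w \<otimes> u"] bexI[of _ "w' \<otimes> v'"]) auto
  qed
qed

lemma frac_eq_iff:
  assumes "s \<in> S" "t \<in> S" "a \<in> carrier R" "b \<in> carrier R"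
  shows "fraction s a = fraction t b \<longleftrightarrow>
    (\<exists>u\<in>carrier R. \<exists>v\<in>carrier R. u \<otimes> s \<in> S \<and> u \<otimes> s = v \<otimes> t \<and> u \<otimes> a = v \<otimes> b)"
  unfolding lfrac_def using eq_equiv_class_iff[OF equiv_rel, of "(s, a)" "(t, b)"] assms
  by (simp add: rel_iff)

lemma frac_eqI:
  assumes "s \<in> S" "t \<in> S" "a \<in> carrier R" "b \<in> carrier R" "u \<in> carrier R" "v \<in> carrier R"
    and "u \<otimes> s \<in> S" "u \<otimes> s = v \<otimes> t" "u \<otimes> a = v \<otimes> b"
  shows "fraction s a = fraction t b"
  unfolding frac_eq_iff[OF assms(1-4)] using assms by blast

lemma frac_expand:
  assumes "s \<in> S" "a \<in> carrier R" "w \<in> carrier R" "w \<otimes> s \<in> S"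
  shows "fraction (w \<otimes> s) (w \<otimes> a) = fraction s a"
  using assms in_carrier[of s] by (intro frac_eqI[of _ _ _ _ \<one> w]) auto

lemma mem_frac:
  assumes "s \<in> S" "a \<in> carrier R" "(t, b) \<in> fraction s a"
  shows "t \<in> S" "b \<in> carrier R"
    "\<exists>u\<in>carrier R. \<exists>v\<in>carrier R. u \<otimes> s \<in> S \<and> u \<otimes> s = v \<otimes> t \<and> u \<otimes> a = v \<otimes> b"
  using assms by (auto simp: lfrac_def rel_iff)

lemma self_mem_frac: "\<lbrakk>s \<in> S; a \<in> carrier R\<rbrakk> \<Longrightarrow> (s, a) \<in> fraction s a"
  unfolding lfrac_def using equiv_class_self[OF equiv_rel] by blast

lemma carrier_Loc: "carrier Loc = {fraction s a | s a. s \<in> S \<and> a \<in> carrier R}"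
  by (auto simp: ore_localization_def lfrac_def quotient_def)

lemma frac_closed [simp, intro]: "\<lbrakk>s \<in> S; a \<in> carrier R\<rbrakk> \<Longrightarrow> fraction s a \<in> carrier Loc"
  unfolding carrier_Loc by blast

text \<open>The numerator \<open>a\<close> may be moved past \<open>t\<close> in many ways; any two become equal after multiplication
  by a suitable denominator. The condition is put on \<open>u s\<close> rather than on \<open>u\<close> because a change of
  representatives turns \<open>u\<close> into \<open>u w\<close>, where only \<open>w s\<close> is known to be a denominator.\<close>

lemma mult_choice:
  assumes "s \<in> S" "a \<in> carrier R" "t \<in> S" "b \<in> carrier R"
    and u: "u \<in> carrier R" "u \<otimes> s \<in> S" "c \<in> carrier R" "u \<otimes> a = c \<otimes> t"
    and v: "v \<in> carrier R" "v \<otimes> s \<in> S" "d \<in> carrier R" "v \<otimes> a = d \<otimes> t"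
  shows "fraction (u \<otimes> s) (c \<otimes> b) = fraction (v \<otimes> s) (d \<otimes> b)"
proof -
  note C = assms(1,3)[THEN in_carrier]
  obtain w w' where w: "w \<in> S" "w' \<in> carrier R" "w \<otimes> u = w' \<otimes> v"
    using equalise[of u v s] assms by auto
  have wc: "w \<in> carrier R" using w in_carrier by blast
  have "(w \<otimes> c) \<otimes> t = (w \<otimes> u) \<otimes> a" using u wc C assms by (simp add: m_assoc)
  also have "\<dots> = w' \<otimes> (v \<otimes> a)" using w v assms by (simp add: m_assoc)
  also have "\<dots> = (w' \<otimes> d) \<otimes> t" using w v C by (simp add: m_assoc)
  finally obtain e where e: "e \<in> S" "e \<otimes> (w \<otimes> c) = e \<otimes> (w' \<otimes> d)"
    using cancel_right[of "w \<otimes> c" "w' \<otimes> d" t] wc u v w assms by auto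
  have ec: "e \<in> carrier R" using e in_carrier by blast
  have 1: "(e \<otimes> w) \<otimes> (u \<otimes> s) = (e \<otimes> w') \<otimes> (v \<otimes> s)"
  proof -
    have "(e \<otimes> w) \<otimes> (u \<otimes> s) = e \<otimes> ((w \<otimes> u) \<otimes> s)" using ec wc u C by (simp add: m_assoc)
    thus ?thesis unfolding w(3) using ec w v C by (simp add: m_assoc)
  qed
  have 2: "(e \<otimes> w) \<otimes> (c \<otimes> b) = (e \<otimes> w') \<otimes> (d \<otimes> b)"
  proof -
    have "(e \<otimes> w) \<otimes> (c \<otimes> b) = (e \<otimes> (w \<otimes> c)) \<otimes> b" using ec wc u assms by (simp add: m_assoc)
    thus ?thesis unfolding e(2) using ec w v assms by (simp add: m_assoc)
  qed
  have 3: "(e \<otimes> w) \<otimes> (u \<otimes> s) \<in> S" using e w u mult_in by blast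
  show ?thesis
    by (rule frac_eqI[OF u(2) v(2) _ _ _ _ 3 1 2]) (use ec wc w u v assms in auto)
qed

text \<open>Expanding the representatives \<open>(s, a)\<close> to \<open>(w s, w a)\<close> and \<open>(t, b)\<close> to \<open>(x t, x b)\<close> produces choices
  that were already available for the unexpanded ones, namely \<open>u w\<close> and \<open>c x\<close>. As equal
  fractions have a common expansion, independence of representatives reduces to \<open>mult_choice\<close>, and
  the union in the definition of the product is a single class.\<close>

lemma frac_mult:
  assumes st: "s \<in> S" "a \<in> carrier R" "t \<in> S" "b \<in> carrier R"
    and u: "u \<in> carrier R" "u \<otimes> s \<in> S" "c \<in> carrier R" "u \<otimes> a = c \<otimes> t"
  shows "fraction s a \<otimes>\<^bsub>Loc\<^esub> fraction t b = fraction (u \<otimes> s) (c \<otimes> b)"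
proof -
  define M where "M = {fraction (u \<otimes> s') (c \<otimes> b') | s' a' t' b' u c.
         (s', a') \<in> fraction s a \<and> (t', b') \<in> fraction t b \<and> u \<in> S \<and> c \<in> carrier R \<and> u \<otimes> a' = c \<otimes> t'}"
  note C = st(1,3)[THEN in_carrier]
  have "P = fraction (u \<otimes> s) (c \<otimes> b)" if PM: "P \<in> M" for P
  proof -
    obtain s' a' t' b' u' c' where P: "P = fraction (u' \<otimes> s') (c' \<otimes> b')"
      and m: "(s', a') \<in> fraction s a" "(t', b') \<in> fraction t b" and u': "u' \<in> S" "c' \<in> carrier R"
      "u' \<otimes> a' = c' \<otimes> t'"
      using PM unfolding M_def by blast
    note S' = mem_frac(1,2)[OF st(1,2) m(1)] mem_frac(1,2)[OF st(3,4) m(2)]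
    note C' = S'(1,3)[THEN in_carrier] in_carrier[OF u'(1)]
    obtain w w' where w: "w \<in> carrier R" "w' \<in> carrier R" "w \<otimes> s \<in> S" "w \<otimes> s = w' \<otimes> s'"
      "w \<otimes> a = w' \<otimes> a'"
      using mem_frac(3)[OF st(1,2) m(1)] by blast
    obtain x x' where x: "x \<in> carrier R" "x' \<in> carrier R" "x \<otimes> t \<in> S" "x \<otimes> t = x' \<otimes> t'"
      "x \<otimes> b = x' \<otimes> b'"
      using mem_frac(3)[OF st(3,4) m(2)] by blast
    obtain u0 c0 where u0: "u0 \<in> S" "c0 \<in> carrier R" "u0 \<otimes> (w \<otimes> a) = c0 \<otimes> (x \<otimes> t)"
      using ore[OF m_closed[OF w(1) st(2)] x(3)] by blast
    note C0 = in_carrier[OF u0(1)]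
    have "fraction (u \<otimes> s) (c \<otimes> b) = fraction ((u0 \<otimes> w) \<otimes> s) ((c0 \<otimes> x) \<otimes> b)"
    proof (rule mult_choice[OF st u])
      show "(u0 \<otimes> w) \<otimes> s \<in> S" using mult_in[OF u0(1) w(3)] w(1) C0 C(1) by (simp add: m_assoc)
      show "(u0 \<otimes> w) \<otimes> a = (c0 \<otimes> x) \<otimes> t"
        using u0(2,3) w(1) x(1) C0 C st(2) by (simp add: m_assoc)
    qed (use C0 u0(2) w(1) x(1) in auto)
    also have "(u0 \<otimes> w) \<otimes> s = (u0 \<otimes> w') \<otimes> s'"
      using w(1,2,4) C0 C(1) C'(1) by (simp add: m_assoc)
    also have "(c0 \<otimes> x) \<otimes> b = (c0 \<otimes> x') \<otimes> b'"
      using x(1,2,5) u0(2) st(4) S'(4) by (simp add: m_assoc)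
    also have "fraction ((u0 \<otimes> w') \<otimes> s') ((c0 \<otimes> x') \<otimes> b') = fraction (u' \<otimes> s') (c' \<otimes> b')"
    proof (rule mult_choice[of _ a' t', OF S'])
      show "u0 \<otimes> w' \<otimes> s' \<in> S"
        using mult_in[OF u0(1) w(3)] w(2) C0 C' unfolding w(4) by (simp add: m_assoc)
      show "u' \<otimes> s' \<in> S" using mult_in u' S' by blast
      show "u0 \<otimes> w' \<otimes> a' = c0 \<otimes> x' \<otimes> t'"
        using u0(2,3) w(2) x(2) C0 C' S'(2) unfolding w(5) x(4) by (simp add: m_assoc)
      show "u' \<otimes> a' = c' \<otimes> t'" by (rule u'(3))
    qed (use u0(2) w(2) x(2) u'(2) C0 C' in auto)
    finally show ?thesis using P by simp
  qed
  moreover have "fraction (u \<otimes> s) (c \<otimes> b) \<in> M"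
  proof -
    obtain u' c' where u': "u' \<in> S" "c' \<in> carrier R" "u' \<otimes> a = c' \<otimes> t"
      using ore[of a t] st by auto
    have "fraction (u \<otimes> s) (c \<otimes> b) = fraction (u' \<otimes> s) (c' \<otimes> b)"

      by (rule mult_choice[OF st u]) (use u' in_carrier[OF u'(1)] mult_in[OF u'(1) st(1)] in auto)
    moreover have "fraction (u' \<otimes> s) (c' \<otimes> b) \<in> M"
      unfolding M_def
      by (intro CollectI exI conjI, rule refl) (use self_mem_frac st u' in auto)
    ultimately show ?thesis by simp
  qed
  ultimately have "M = {fraction (u \<otimes> s) (c \<otimes> b)}" by blast
  thus ?thesis by (simp add: ore_localization_def lfrac_mult_def M_def)
qed

text \<open>As for products, two ways of finding a common denominator become equal after multiplication by a
  suitable denominator.\<close>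

lemma add_choice:
  assumes "s \<in> S" "a \<in> carrier R" "t \<in> S" "b \<in> carrier R"
    and u: "u \<in> carrier R" "u \<otimes> s \<in> S" "c \<in> carrier R" "u \<otimes> s = c \<otimes> t"
    and v: "v \<in> carrier R" "v \<otimes> s \<in> S" "d \<in> carrier R" "v \<otimes> s = d \<otimes> t"
  shows "fraction (u \<otimes> s) (u \<otimes> a \<oplus> c \<otimes> b) = fraction (v \<otimes> s) (v \<otimes> a \<oplus> d \<otimes> b)"
proof -
  note C = assms(1,3)[THEN in_carrier]
  obtain w w' where w: "w \<in> S" "w' \<in> carrier R" "w \<otimes> u = w' \<otimes> v"
    using equalise[of u v s] assms by auto
  have wc: "w \<in> carrier R" using w in_carrier by blast
  have "(w \<otimes> c) \<otimes> t = (w \<otimes> u) \<otimes> s" using u wc C assms by (simp add: m_assoc)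
  also have "\<dots> = w' \<otimes> (v \<otimes> s)" using w v C by (simp add: m_assoc)
  also have "\<dots> = (w' \<otimes> d) \<otimes> t" using w v C by (simp add: m_assoc)
  finally obtain e where e: "e \<in> S" "e \<otimes> (w \<otimes> c) = e \<otimes> (w' \<otimes> d)"
    using cancel_right[of "w \<otimes> c" "w' \<otimes> d" t] wc u v w assms by auto
  have ec: "e \<in> carrier R" using e in_carrier by blast
  have 1: "(e \<otimes> w) \<otimes> (u \<otimes> r) = (e \<otimes> w') \<otimes> (v \<otimes> r)" if "r \<in> carrier R" for r
  proof -
    have "(e \<otimes> w) \<otimes> (u \<otimes> r) = e \<otimes> ((w \<otimes> u) \<otimes> r)" using ec wc u that by (simp add: m_assoc)
    thus ?thesis unfolding w(3) using ec w v that by (simp add: m_assoc)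
  qed
  have 2: "(e \<otimes> w) \<otimes> (c \<otimes> b) = (e \<otimes> w') \<otimes> (d \<otimes> b)"
  proof -
    have "(e \<otimes> w) \<otimes> (c \<otimes> b) = (e \<otimes> (w \<otimes> c)) \<otimes> b" using ec wc u assms by (simp add: m_assoc)
    thus ?thesis unfolding e(2) using ec w v assms by (simp add: m_assoc)
  qed
  have 3: "(e \<otimes> w) \<otimes> (u \<otimes> s) \<in> S" using e w u mult_in by blast
  have 4: "(e \<otimes> w) \<otimes> (u \<otimes> a \<oplus> c \<otimes> b) = (e \<otimes> w') \<otimes> (v \<otimes> a \<oplus> d \<otimes> b)"
    using 1[OF assms(2)] 2 ec wc w u v assms by (simp add: r_distr)
  show ?thesis
    by (rule frac_eqI[OF u(2) v(2) _ _ _ _ 3 1[OF C(1)] 4]) (use ec wc w u v assms in auto)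
qed

lemma frac_add:
  assumes st: "s \<in> S" "a \<in> carrier R" "t \<in> S" "b \<in> carrier R"
    and u: "u \<in> carrier R" "u \<otimes> s \<in> S" "v \<in> carrier R" "u \<otimes> s = v \<otimes> t"
  shows "fraction s a \<oplus>\<^bsub>Loc\<^esub> fraction t b = fraction (u \<otimes> s) (u \<otimes> a \<oplus> v \<otimes> b)"
proof -
  define M where "M = {fraction (u \<otimes> s') (u \<otimes> a' \<oplus> v \<otimes> b') | s' a' t' b' u v.
         (s', a') \<in> fraction s a \<and> (t', b') \<in> fraction t b \<and> u \<in> carrier R \<and> v \<in> carrier R \<and>
         u \<otimes> s' \<in> S \<and> u \<otimes> s' = v \<otimes> t'}"
  note C = st(1,3)[THEN in_carrier]
  have "P = fraction (u \<otimes> s) (u \<otimes> a \<oplus> v \<otimes> b)" if PM: "P \<in> M" for P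
  proof -
    obtain s' a' t' b' u' v' where P: "P = fraction (u' \<otimes> s') (u' \<otimes> a' \<oplus> v' \<otimes> b')"
      and m: "(s', a') \<in> fraction s a" "(t', b') \<in> fraction t b" and u': "u' \<in> carrier R" "v' \<in> carrier R"
      "u' \<otimes> s' \<in> S" "u' \<otimes> s' = v' \<otimes> t'"
      using PM unfolding M_def by blast
    note S' = mem_frac(1,2)[OF st(1,2) m(1)] mem_frac(1,2)[OF st(3,4) m(2)]
    note C' = S'(1,3)[THEN in_carrier]
    obtain w w' where w: "w \<in> carrier R" "w' \<in> carrier R" "w \<otimes> s \<in> S" "w \<otimes> s = w' \<otimes> s'"
      "w \<otimes> a = w' \<otimes> a'"
      using mem_frac(3)[OF st(1,2) m(1)] by blast
    obtain x x' where x: "x \<in> carrier R" "x' \<in> carrier R" "x \<otimes> t \<in> S" "x \<otimes> t = x' \<otimes> t'"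
      "x \<otimes> b = x' \<otimes> b'"
      using mem_frac(3)[OF st(3,4) m(2)] by blast
    obtain u0 c0 where u0: "u0 \<in> S" "c0 \<in> carrier R" "u0 \<otimes> (w \<otimes> s) = c0 \<otimes> (x \<otimes> t)"
      using ore[OF m_closed[OF w(1) C(1)] x(3)] by blast
    note C0 = in_carrier[OF u0(1)]
    have "fraction (u \<otimes> s) (u \<otimes> a \<oplus> v \<otimes> b) = fraction ((u0 \<otimes> w) \<otimes> s) ((u0 \<otimes> w) \<otimes> a \<oplus> (c0 \<otimes> x) \<otimes> b)"
    proof (rule add_choice[OF st u])
      show "(u0 \<otimes> w) \<otimes> s \<in> S" using mult_in[OF u0(1) w(3)] w(1) C0 C(1) by (simp add: m_assoc)
      show "(u0 \<otimes> w) \<otimes> s = (c0 \<otimes> x) \<otimes> t"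
        using u0(2,3) w(1) x(1) C0 C by (simp add: m_assoc)
    qed (use C0 u0(2) w(1) x(1) in auto)
    also have "(u0 \<otimes> w) \<otimes> s = (u0 \<otimes> w') \<otimes> s'"
      using w(1,2,4) C0 C(1) C'(1) by (simp add: m_assoc)
    also have "(c0 \<otimes> x) \<otimes> b = (c0 \<otimes> x') \<otimes> b'"
      using x(1,2,5) u0(2) st(4) S'(4) by (simp add: m_assoc)
    also have "(u0 \<otimes> w) \<otimes> a = (u0 \<otimes> w') \<otimes> a'"
      using w(1,2,5) C0 st(2) S'(2) by (simp add: m_assoc)
    also have "fraction ((u0 \<otimes> w') \<otimes> s') ((u0 \<otimes> w') \<otimes> a' \<oplus> (c0 \<otimes> x') \<otimes> b')
      = fraction (u' \<otimes> s') (u' \<otimes> a' \<oplus> v' \<otimes> b')"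
    proof (rule add_choice[of _ _ t', OF S'])
      show "u0 \<otimes> w' \<otimes> s' \<in> S"
        using mult_in[OF u0(1) w(3)] w(2) C0 C' unfolding w(4) by (simp add: m_assoc)
      show "u0 \<otimes> w' \<otimes> s' = c0 \<otimes> x' \<otimes> t'"
        using u0(2,3) w(2) x(2) C0 C' unfolding w(4) x(4) by (simp add: m_assoc)
      show "u' \<otimes> s' \<in> S" "u' \<otimes> s' = v' \<otimes> t'" by (rule u'(3), rule u'(4))
    qed (use u0(2) w(2) x(2) u'(1,2) C0 in auto)
    finally show ?thesis using P by simp
  qed
  moreover have "fraction (u \<otimes> s) (u \<otimes> a \<oplus> v \<otimes> b) \<in> M"
    unfolding M_def
    by (intro CollectI exI conjI, rule refl) (use self_mem_frac st u in auto)
  ultimately have "M = {fraction (u \<otimes> s) (u \<otimes> a \<oplus> v \<otimes> b)}" by blast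
  thus ?thesis by (simp add: ore_localization_def lfrac_add_def M_def)
qed

text \<open>Every product can be brought to this form by \<open>frac_numerator_through\<close>, and here the denominator of
  the second factor simply cancels. This makes the ring axioms for products immediate.\<close>

lemma frac_mult_chain:
  assumes "s \<in> S" "t \<in> S" "d \<in> carrier R" "b \<in> carrier R"
  shows "fraction s (d \<otimes> t) \<otimes>\<^bsub>Loc\<^esub> fraction t b = fraction s (d \<otimes> b)"
  using frac_mult[of s "d \<otimes> t" t b \<one> d] assms in_carrier by simp

lemma frac_add_same:
  assumes "s \<in> S" "a \<in> carrier R" "b \<in> carrier R"
  shows "fraction s a \<oplus>\<^bsub>Loc\<^esub> fraction s b = fraction s (a \<oplus> b)"
  using frac_add[of s a s b \<one> \<one>] assms in_carrier by simp

lemma numerator_through: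
  assumes "s \<in> S" "a \<in> carrier R" "t \<in> S"
  shows "\<exists>u\<in>S. \<exists>d\<in>carrier R. u \<otimes> s \<in> S \<and> u \<otimes> a = d \<otimes> t \<and> fraction s a = fraction (u \<otimes> s) (d \<otimes> t)"
proof -
  obtain u d where u: "u \<in> S" "d \<in> carrier R" "u \<otimes> a = d \<otimes> t"
    using ore[of a t] assms by blast
  have "fraction s a = fraction (u \<otimes> s) (d \<otimes> t)"
    using frac_expand[OF assms(1,2) in_carrier[OF u(1)] mult_in[OF u(1) assms(1)]] unfolding u(3) ..
  thus ?thesis using u mult_in assms by blast
qed

lemma common_denominator:
  assumes "A \<in> carrier Loc" "t \<in> S"
  shows "\<exists>u\<in>carrier R. \<exists>a\<in>carrier R. u \<otimes> t \<in> S \<and> A = fraction (u \<otimes> t) a"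
proof -
  obtain s a where A: "A = fraction s a" "s \<in> S" "a \<in> carrier R"
    using assms unfolding carrier_Loc by blast
  obtain w u where w: "w \<in> S" "u \<in> carrier R" "w \<otimes> s = u \<otimes> t"
    using ore[of s t] assms A in_carrier by blast
  have "w \<otimes> s \<in> S" using w A mult_in by blast
  with w have ut: "u \<otimes> t \<in> S" "w \<otimes> s \<in> S" by auto
  have "A = fraction (w \<otimes> s) (w \<otimes> a)" using frac_expand[of s a w] ut w A in_carrier by simp
  hence "A = fraction (u \<otimes> t) (w \<otimes> a)" using w by simp
  moreover have "w \<otimes> a \<in> carrier R" using w A in_carrier by simp
  ultimately show ?thesis using w ut by blast
qed

lemma two_fracs:
  assumes "A \<in> carrier Loc" "B \<in> carrier Loc"
  shows "\<exists>s\<in>S. \<exists>a\<in>carrier R. \<exists>b\<in>carrier R. A = fraction s a \<and> B = fraction s b"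
proof -
  obtain t b where B: "B = fraction t b" "t \<in> S" "b \<in> carrier R"
    using assms unfolding carrier_Loc by blast
  obtain u a where u: "u \<in> carrier R" "a \<in> carrier R" "u \<otimes> t \<in> S" "A = fraction (u \<otimes> t) a"
    using common_denominator[OF assms(1) B(2)] by blast
  have "B = fraction (u \<otimes> t) (u \<otimes> b)" using B u by (simp add: frac_expand)
  thus ?thesis using u B by blast
qed

lemma three_fracs:
  assumes "A \<in> carrier Loc" "B \<in> carrier Loc" "C \<in> carrier Loc"
  shows "\<exists>s\<in>S. \<exists>a\<in>carrier R. \<exists>b\<in>carrier R. \<exists>c\<in>carrier R. A = fraction s a \<and> B = fraction s b \<and> C = fraction s c"
proof -
  obtain t b c where B: "t \<in> S" "b \<in> carrier R" "c \<in> carrier R" "B = fraction t b" "C = fraction t c"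
    using two_fracs[OF assms(2,3)] by blast
  obtain u a where u: "u \<in> carrier R" "a \<in> carrier R" "u \<otimes> t \<in> S" "A = fraction (u \<otimes> t) a"
    using common_denominator[OF assms(1) B(1)] by blast
  have "B = fraction (u \<otimes> t) (u \<otimes> b)" "C = fraction (u \<otimes> t) (u \<otimes> c)" using B u by (simp_all add: frac_expand)
  moreover have "u \<otimes> b \<in> carrier R" "u \<otimes> c \<in> carrier R" using B(2,3) u(1) by auto
  ultimately show ?thesis using u(2-4) by blast
qed

lemma one_Loc: "\<one>\<^bsub>Loc\<^esub> = fraction \<one> \<one>" and zero_Loc: "\<zero>\<^bsub>Loc\<^esub> = fraction \<one> \<zero>"
  by (simp_all add: ore_localization_def)

lemma frac_self: "s \<in> S \<Longrightarrow> fraction s s = \<one>\<^bsub>Loc\<^esub>"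
  using frac_expand[of \<one> \<one> s] one_in in_carrier by (simp add: one_Loc)

lemma frac_zero: "s \<in> S \<Longrightarrow> fraction s \<zero> = \<zero>\<^bsub>Loc\<^esub>"
  using frac_expand[of \<one> \<zero> s] one_in in_carrier by (simp add: zero_Loc)

lemma frac_numerator_through:
  assumes "A \<in> carrier Loc" "t \<in> S"
  obtains s d where "s \<in> S" "d \<in> carrier R" "A = fraction s (d \<otimes> t)"
proof -
  obtain r a where A: "A = fraction r a" "r \<in> S" "a \<in> carrier R"
    using assms unfolding carrier_Loc by blast
  show thesis using numerator_through[OF A(2,3) assms(2)] that unfolding A(1) by blast
qed

lemma mult_Loc_closed:
  assumes "A \<in> carrier Loc" "B \<in> carrier Loc" shows "A \<otimes>\<^bsub>Loc\<^esub> B \<in> carrier Loc"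
proof -
  obtain t b where B: "B = fraction t b" "t \<in> S" "b \<in> carrier R"
    using assms unfolding carrier_Loc by blast
  obtain s a where A: "s \<in> S" "a \<in> carrier R" "A = fraction s (a \<otimes> t)"
    using frac_numerator_through[OF assms(1) B(2)] .
  show ?thesis unfolding A(3) B(1) using A(1,2) B(2,3) by (simp add: frac_mult_chain)
qed

lemma add_Loc_closed:
  assumes "A \<in> carrier Loc" "B \<in> carrier Loc" shows "A \<oplus>\<^bsub>Loc\<^esub> B \<in> carrier Loc"
  using two_fracs[OF assms] by (auto simp: frac_add_same)

lemma ring_Loc: "ring Loc"
proof (rule ringI)
  show "abelian_group Loc"
  proof (rule abelian_groupI)
    fix A B C assume A: "A \<in> carrier Loc" "B \<in> carrier Loc" "C \<in> carrier Loc"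
    show "A \<oplus>\<^bsub>Loc\<^esub> B \<oplus>\<^bsub>Loc\<^esub> C = A \<oplus>\<^bsub>Loc\<^esub> (B \<oplus>\<^bsub>Loc\<^esub> C)"
      using three_fracs[OF A] by (auto simp: frac_add_same a_assoc)
  next
    fix A B assume A: "A \<in> carrier Loc" "B \<in> carrier Loc"
    show "A \<oplus>\<^bsub>Loc\<^esub> B \<in> carrier Loc" by (rule add_Loc_closed[OF A])
    show "A \<oplus>\<^bsub>Loc\<^esub> B = B \<oplus>\<^bsub>Loc\<^esub> A"
      using two_fracs[OF A] by (auto simp: frac_add_same a_comm)
  next
    fix A assume "A \<in> carrier Loc"
    then obtain s a where A: "A = fraction s a" "s \<in> S" "a \<in> carrier R"
      unfolding carrier_Loc by blast
    show "\<zero>\<^bsub>Loc\<^esub> \<oplus>\<^bsub>Loc\<^esub> A = A"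
      using A by (simp add: frac_zero[symmetric, of s] frac_add_same)
    show "\<exists>B\<in>carrier Loc. B \<oplus>\<^bsub>Loc\<^esub> A = \<zero>\<^bsub>Loc\<^esub>"
      using A by (intro bexI[of _ "fraction s (\<ominus> a)"]) (auto simp: frac_add_same l_neg frac_zero)
  qed (use one_in in \<open>auto simp: zero_Loc\<close>)
  show "monoid Loc"
  proof (rule monoidI)
    fix A B C assume AL: "A \<in> carrier Loc" "B \<in> carrier Loc" "C \<in> carrier Loc"
    obtain r c where C: "C = fraction r c" "r \<in> S" "c \<in> carrier R"
      using AL unfolding carrier_Loc by blast
    obtain t b where B: "t \<in> S" "b \<in> carrier R" "B = fraction t (b \<otimes> r)"
      using frac_numerator_through[OF AL(2) C(2)] .
    obtain s a where A: "s \<in> S" "a \<in> carrier R" "A = fraction s (a \<otimes> t)"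
      using frac_numerator_through[OF AL(1) B(1)] .
    have "A \<otimes>\<^bsub>Loc\<^esub> B \<otimes>\<^bsub>Loc\<^esub> C = fraction s ((a \<otimes> b) \<otimes> r) \<otimes>\<^bsub>Loc\<^esub> C"
      using A B C in_carrier by (simp add: frac_mult_chain m_assoc)
    also have "\<dots> = fraction s (a \<otimes> (b \<otimes> c))"
      unfolding C(1) using A B C in_carrier by (subst frac_mult_chain) (auto simp: m_assoc)
    also have "\<dots> = A \<otimes>\<^bsub>Loc\<^esub> (B \<otimes>\<^bsub>Loc\<^esub> C)"
      using A B C by (simp add: frac_mult_chain)
    finally show "A \<otimes>\<^bsub>Loc\<^esub> B \<otimes>\<^bsub>Loc\<^esub> C = A \<otimes>\<^bsub>Loc\<^esub> (B \<otimes>\<^bsub>Loc\<^esub> C)" .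
  next
    fix A assume "A \<in> carrier Loc"
    then obtain s a where A: "A = fraction s a" "s \<in> S" "a \<in> carrier R"
      unfolding carrier_Loc by blast
    show "\<one>\<^bsub>Loc\<^esub> \<otimes>\<^bsub>Loc\<^esub> A = A"
      using A frac_mult_chain[of s s \<one> a] in_carrier by (simp add: frac_self)
    show "A \<otimes>\<^bsub>Loc\<^esub> \<one>\<^bsub>Loc\<^esub> = A"
      using A frac_mult_chain[of s \<one> a \<one>] one_in by (simp add: one_Loc)
  qed (use one_in mult_Loc_closed in \<open>auto simp: one_Loc\<close>)
next
  fix A B C assume AL: "A \<in> carrier Loc" "B \<in> carrier Loc" "C \<in> carrier Loc"
  show "(A \<oplus>\<^bsub>Loc\<^esub> B) \<otimes>\<^bsub>Loc\<^esub> C = A \<otimes>\<^bsub>Loc\<^esub> C \<oplus>\<^bsub>Loc\<^esub> B \<otimes>\<^bsub>Loc\<^esub> C"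
  proof -
    obtain t c where C: "C = fraction t c" "t \<in> S" "c \<in> carrier R"
      using AL unfolding carrier_Loc by blast
    obtain s a b where AB: "s \<in> S" "a \<in> carrier R" "b \<in> carrier R" "A = fraction s a" "B = fraction s b"
      using two_fracs[OF AL(1,2)] by blast
    obtain u d where u: "u \<in> S" "d \<in> carrier R" "u \<otimes> s \<in> S" "u \<otimes> a = d \<otimes> t" "A = fraction (u \<otimes> s) (d \<otimes> t)"
      using numerator_through[of s a t] AB C by auto
    have ub: "u \<otimes> b \<in> carrier R" "B = fraction (u \<otimes> s) (u \<otimes> b)"
      using AB u in_carrier[OF u(1)] by (auto simp: frac_expand)
    obtain w e where w: "w \<in> S" "e \<in> carrier R" "w \<otimes> (u \<otimes> s) \<in> S" "w \<otimes> (u \<otimes> b) = e \<otimes> t"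
      "B = fraction (w \<otimes> (u \<otimes> s)) (e \<otimes> t)"
      using numerator_through[of "u \<otimes> s" "u \<otimes> b" t] ub u C by auto
    have A: "A = fraction (w \<otimes> (u \<otimes> s)) ((w \<otimes> d) \<otimes> t)"
      using u w C in_carrier frac_expand[of "u \<otimes> s" "d \<otimes> t" w] by (simp add: m_assoc)
    have wd: "w \<otimes> d \<in> carrier R" and tc: "t \<in> carrier R" using u w C in_carrier by auto
    have "A \<oplus>\<^bsub>Loc\<^esub> B = fraction (w \<otimes> (u \<otimes> s)) (((w \<otimes> d) \<oplus> e) \<otimes> t)"
      unfolding A w(5) using w C wd tc by (simp add: frac_add_same l_distr)
    hence "(A \<oplus>\<^bsub>Loc\<^esub> B) \<otimes>\<^bsub>Loc\<^esub> C = fraction (w \<otimes> (u \<otimes> s)) (((w \<otimes> d) \<oplus> e) \<otimes> c)"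
      using w C wd by (simp add: frac_mult_chain)
    also have "\<dots> = A \<otimes>\<^bsub>Loc\<^esub> C \<oplus>\<^bsub>Loc\<^esub> B \<otimes>\<^bsub>Loc\<^esub> C"
      unfolding A w(5) C(1) using w C wd by (simp add: frac_mult_chain frac_add_same l_distr)
    finally show ?thesis .
  qed
  show "C \<otimes>\<^bsub>Loc\<^esub> (A \<oplus>\<^bsub>Loc\<^esub> B) = C \<otimes>\<^bsub>Loc\<^esub> A \<oplus>\<^bsub>Loc\<^esub> C \<otimes>\<^bsub>Loc\<^esub> B"
  proof -
    obtain t a b where AB: "t \<in> S" "a \<in> carrier R" "b \<in> carrier R" "A = fraction t a" "B = fraction t b"
      using two_fracs[OF AL(1,2)] by blast
    obtain s c where C: "s \<in> S" "c \<in> carrier R" "C = fraction s (c \<otimes> t)"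
      using frac_numerator_through[OF AL(3) AB(1)] .
    show ?thesis
      unfolding AB(4,5) C(3) using AB(1-3) C(1,2) by (simp add: frac_add_same frac_mult_chain r_distr)
  qed
qed

lemma frac_one_hom: "fraction \<one> \<in> ring_hom R Loc"
proof (rule ring_hom_memI)
  fix a b assume ab: "a \<in> carrier R" "b \<in> carrier R"
  show "fraction \<one> (a \<otimes> b) = fraction \<one> a \<otimes>\<^bsub>Loc\<^esub> fraction \<one> b"
    using frac_mult_chain[of \<one> \<one> a b] ab one_in by simp
qed (use one_in in \<open>auto simp: frac_add_same one_Loc\<close>)

lemma frac_split:
  assumes "s \<in> S" "a \<in> carrier R"
  shows "fraction s a = fraction s \<one> \<otimes>\<^bsub>Loc\<^esub> fraction \<one> a"
  using frac_mult_chain[of s \<one> \<one> a] assms one_in by simp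

lemma frac_inverse:
  assumes "s \<in> S"
  shows "fraction s \<one> \<otimes>\<^bsub>Loc\<^esub> fraction \<one> s = \<one>\<^bsub>Loc\<^esub>" "fraction \<one> s \<otimes>\<^bsub>Loc\<^esub> fraction s \<one> = \<one>\<^bsub>Loc\<^esub>"
proof -
  show "fraction s \<one> \<otimes>\<^bsub>Loc\<^esub> fraction \<one> s = \<one>\<^bsub>Loc\<^esub>"
    unfolding frac_split[OF assms in_carrier[OF assms], symmetric] by (rule frac_self[OF assms])
  show "fraction \<one> s \<otimes>\<^bsub>Loc\<^esub> fraction s \<one> = \<one>\<^bsub>Loc\<^esub>"
    using frac_mult_chain[OF one_in assms one_closed one_closed] in_carrier[OF assms]
    by (simp add: one_Loc)
qed

text \<open>A vanishing unit would give a denominator of the form \<open>v 0\<close>.\<close>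

lemma one_neq_zero_Loc:
  assumes "\<zero> \<notin> S"
  shows "\<one>\<^bsub>Loc\<^esub> \<noteq> \<zero>\<^bsub>Loc\<^esub>"
proof
  assume "\<one>\<^bsub>Loc\<^esub> = \<zero>\<^bsub>Loc\<^esub>"
  then obtain u v where "u \<in> carrier R" "v \<in> carrier R" "u \<otimes> \<one> \<in> S" "u \<otimes> \<one> = v \<otimes> \<zero>"
    unfolding one_Loc zero_Loc using one_in by (subst (asm) frac_eq_iff) auto
  thus False using assms by simp
qed

end

section \<open>Free algebras as linear spans of words\<close>

lemma Free_simps [simp]:
  "carrier Free = UNIV" "f \<otimes>\<^bsub>Free\<^esub> g = f * g" "f \<oplus>\<^bsub>Free\<^esub> g = f + g" "\<one>\<^bsub>Free\<^esub> = 1" "\<zero>\<^bsub>Free\<^esub> = 0"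
  by (simp_all add: ring_of_type_algebra_def)

lemma single_induct [case_names single add]:
  fixes f :: "'a \<Rightarrow>\<^sub>0 'b::ab_group_add"
  assumes "\<And>w c. P (Poly_Mapping.single w c)" "\<And>f g. P f \<Longrightarrow> P g \<Longrightarrow> P (f + g)"
  shows "P f"
proof (induction f rule: update_induct)
  case const
  show ?case using assms(1)[of undefined 0] by simp
next
  case (update f a b)
  have "Poly_Mapping.update a b f = f + Poly_Mapping.single a b"
    using update(1) by (intro poly_mapping_eqI) (auto simp: lookup_update lookup_add lookup_single when_def in_keys_iff)
  thus ?case using assms update by simp
qed

lemma scal_hom [simp]:
  "scal 0 = 0" "scal 1 = 1"
  and scal_add: "scal (a + b) = scal a + scal b"
  and scal_minus: "scal (a - b) = scal a - scal b"
  and scal_mult: "scal (a * b) = scal a * scal b"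
  by (simp_all add: scal_def single_add single_diff mult_single)

lemma scal_comm: "f * scal c = scal c * f"
  by (induction f rule: single_induct) (simp_all add: scal_def mult_single algebra_simps)

lemma scal_left_comm: "f * (scal c * g) = scal c * (f * g)"
  by (metis mult.assoc scal_comm)

lemma scal_mult_scal: "(scal a * f) * (scal b * g) = scal (a * b) * (f * g)"
  by (simp only: mult.assoc scal_left_comm[of f] scal_mult)

lemma scal_inverse_cancel: "c \<noteq> 0 \<Longrightarrow> scal (inverse c) * (scal c * f) = f"
  by (simp add: mult.assoc[symmetric] scal_mult[symmetric])

lemma single_word: "Poly_Mapping.single (Word ws) c = scal c * prod_list (map fvar ws)"
proof (induction ws)
  case Nil
  show ?case by (simp add: zero_word_def[symmetric] scal_def)
next
  case (Cons g ws)
  have "Poly_Mapping.single (Word (g # ws)) c = fvar g * Poly_Mapping.single (Word ws) c"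
    by (simp add: fvar_def mult_single)
  thus ?case using Cons by (simp add: scal_left_comm)
qed

lemma free_algebra_induct [case_names scal var add mult]:
  assumes "\<And>c. P (scal c)" "\<And>g. P (fvar g)" "\<And>f g. P f \<Longrightarrow> P g \<Longrightarrow> P (f + g)"
    "\<And>f g. P f \<Longrightarrow> P g \<Longrightarrow> P (f * g)"
  shows "P f"
proof (induction f rule: single_induct)
  case (single w c)
  obtain ws where w: "w = Word ws" by (cases w)
  have "P (prod_list (map fvar ws))"
  proof (induction ws)
    case Nil
    show ?case using assms(1)[of 1] by simp
  qed (use assms in simp)
  thus ?case unfolding w single_word using assms by blast
qed (use assms in blast)

fun word_weight :: "('g \<Rightarrow> 'k::field) \<Rightarrow> 'g word \<Rightarrow> 'k" where
  "word_weight \<kappa> (Word ws) = prod_list (map \<kappa> ws)"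

text \<open>Rescaling of the variables, \<open>g \<mapsto> \<kappa>(g) g\<close>, extended to an endomorphism of the free algebra.\<close>

definition twist :: "('g \<Rightarrow> 'k) \<Rightarrow> ('g, 'k::field) free_algebra \<Rightarrow> ('g, 'k) free_algebra" where
  "twist \<kappa> f = (\<Sum>w\<in>Poly_Mapping.keys f. Poly_Mapping.single w (word_weight \<kappa> w * Poly_Mapping.lookup f w))"

lemma word_weight_add: "word_weight \<kappa> (v + w) = word_weight \<kappa> v * word_weight \<kappa> w"
  by (cases v; cases w) simp

lemma twist_single: "twist \<kappa> (Poly_Mapping.single w c) = Poly_Mapping.single w (word_weight \<kappa> w * c)"
  by (cases "c = 0") (simp_all add: twist_def)

lemma twist_add: "twist \<kappa> (f + g) = twist \<kappa> f + twist \<kappa> g"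
  unfolding twist_def
  by (rule setsum_keys_plus_distrib) (simp_all add: single_add[symmetric] distrib_left)

lemma twist_scal [simp]: "twist \<kappa> (scal c) = scal c"
  by (simp add: scal_def twist_single zero_word_def)

lemma twist_0 [simp]: "twist \<kappa> 0 = 0" and twist_1 [simp]: "twist \<kappa> 1 = 1"
  using twist_scal[of \<kappa> 0] twist_scal[of \<kappa> 1] by simp_all

lemma twist_minus: "twist \<kappa> (f - g) = twist \<kappa> f - twist \<kappa> g"
  using twist_add[of \<kappa> "f - g" g] by (simp add: algebra_simps)

lemma twist_var [simp]: "twist \<kappa> (fvar g) = scal (\<kappa> g) * fvar g"
  by (simp add: fvar_def scal_def twist_single mult_single)

lemma twist_mult: "twist \<kappa> (f * g) = twist \<kappa> f * twist \<kappa> g"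
proof (induction f rule: single_induct)
  case (single v a)
  show ?case
    by (induction g rule: single_induct)
      (simp_all add: twist_single mult_single word_weight_add twist_add distrib_left ac_simps)
qed (simp add: distrib_right twist_add)

lemma twist_power: "twist \<kappa> (f ^ n) = twist \<kappa> f ^ n"
  by (induction n) (simp_all add: twist_mult)

section \<open>Congruence modulo the defining relations\<close>

locale quantum_weyl =
  fixes p q lam mu :: "'k::field"
  assumes nz: "p \<noteq> 0" "q \<noteq> 0" "lam \<noteq> 0" "mu \<noteq> 0"
begin

abbreviation "W \<equiv> weyl_ideal p q lam mu"

definition cong :: "(gen, 'k) free_algebra \<Rightarrow> (gen, 'k) free_algebra \<Rightarrow> bool" (infix "\<doteq>" 50)
  where "f \<doteq> g \<longleftrightarrow> f - g \<in> W"

lemma W_zero: "0 \<in> W"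
  using additive_subgroup.zero_closed[OF ideal.axioms(1)[OF ideal_weyl_ideal]] by simp

lemma W_add: "\<lbrakk>f \<in> W; g \<in> W\<rbrakk> \<Longrightarrow> f + g \<in> W"
  using additive_subgroup.a_closed[OF ideal.axioms(1)[OF ideal_weyl_ideal]] by fastforce

lemma W_left: "f \<in> W \<Longrightarrow> h * f \<in> W" and W_right: "f \<in> W \<Longrightarrow> f * h \<in> W"
  using ideal.I_l_closed[OF ideal_weyl_ideal] ideal.I_r_closed[OF ideal_weyl_ideal] by fastforce+

lemma W_uminus: "f \<in> W \<Longrightarrow> - f \<in> W"
  using W_left[of f "-1"] by simp

lemma W_minus: "\<lbrakk>f \<in> W; g \<in> W\<rbrakk> \<Longrightarrow> f - g \<in> W"
  using W_add[of f "- g"] W_uminus by simp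

lemma ideal_FreeI:
  assumes "0 \<in> K" "\<And>f g. f \<in> K \<Longrightarrow> g \<in> K \<Longrightarrow> f + g \<in> K"
    "\<And>f h. f \<in> K \<Longrightarrow> h * f \<in> K" "\<And>f h. f \<in> K \<Longrightarrow> f * h \<in> K"
  shows "ideal K (Free :: (gen, 'k) free_algebra ring)"
proof (rule idealI[OF ring_Free])
  interpret F: ring "Free :: (gen, 'k) free_algebra ring" by (rule ring_Free)
  show "subgroup K (add_monoid Free)"
  proof (rule group.subgroupI[OF F.a_group])
    fix a assume a: "a \<in> K"
    have "\<ominus>\<^bsub>Free\<^esub> a = - a"
      by (rule F.minus_equality) simp_all
    moreover have "- a \<in> K" using assms(3)[OF a, of "- 1"] by simp
    ultimately show "inv\<^bsub>add_monoid Free\<^esub> a \<in> K" by (simp add: a_inv_def)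
  qed (use assms in auto)
qed (use assms in auto)

lemma W_least:
  assumes "0 \<in> K" "\<And>f g. f \<in> K \<Longrightarrow> g \<in> K \<Longrightarrow> f + g \<in> K"
    "\<And>f h. f \<in> K \<Longrightarrow> h * f \<in> K" "\<And>f h. f \<in> K \<Longrightarrow> f * h \<in> K"
    and "weyl_rels p q lam mu \<subseteq> K"
  shows "W \<subseteq> K"
  unfolding weyl_ideal_def
  by (rule ring.genideal_minimal[OF ring_Free ideal_FreeI]) (use assms in auto)

lemma rels_in_W: "weyl_rels p q lam mu \<subseteq> W"
  unfolding weyl_ideal_def by (rule ring.genideal_self[OF ring_Free]) simp

lemma cong_refl [simp, intro]: "f \<doteq> f"
  by (simp add: cong_def W_zero)

lemma cong_sym: "f \<doteq> g \<Longrightarrow> g \<doteq> f"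
  unfolding cong_def using W_uminus[of "f - g"] by simp

lemma cong_trans [trans]: "\<lbrakk>f \<doteq> g; g \<doteq> h\<rbrakk> \<Longrightarrow> f \<doteq> h"
  unfolding cong_def using W_add[of "f - g" "g - h"] by simp

lemma cong_add: "\<lbrakk>f \<doteq> f'; g \<doteq> g'\<rbrakk> \<Longrightarrow> f + g \<doteq> f' + g'"
  unfolding cong_def using W_add[of "f - f'" "g - g'"] by (simp add: algebra_simps)

lemma cong_minus: "\<lbrakk>f \<doteq> f'; g \<doteq> g'\<rbrakk> \<Longrightarrow> f - g \<doteq> f' - g'"
  unfolding cong_def using W_minus[of "f - f'" "g - g'"] by (simp add: algebra_simps)

lemma cong_left: "f \<doteq> g \<Longrightarrow> h * f \<doteq> h * g"
  unfolding cong_def using W_left[of "f - g" h] by (simp add: algebra_simps)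

lemma cong_right: "f \<doteq> g \<Longrightarrow> f * h \<doteq> g * h"
  unfolding cong_def using W_right[of "f - g" h] by (simp add: algebra_simps)

lemma cong_sum: "(\<And>m. m \<in> F \<Longrightarrow> f m \<doteq> g m) \<Longrightarrow> sum f F \<doteq> sum g F"
  by (induction F rule: infinite_finite_induct) (auto intro: cong_add)

lemma cong_zero_iff: "f \<doteq> 0 \<longleftrightarrow> f \<in> W"
  by (simp add: cong_def)

text \<open>Commutation up to a scalar. It is multiplicative in both arguments, which reduces all
  commutation rules between monomials to those between \<open>x\<close>, \<open>y\<close>, \<open>z\<close>, \<open>s\<close> and \<open>t\<close>.\<close>

definition skew :: "'k \<Rightarrow> (gen, 'k) free_algebra \<Rightarrow> (gen, 'k) free_algebra \<Rightarrow> bool" where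
  "skew c a b \<longleftrightarrow> a * b \<doteq> scal c * (b * a)"

lemma skew_scal: "skew 1 a (scal c)" "skew 1 (scal c) a"
  by (simp_all add: skew_def scal_comm)

lemma skew_self: "skew 1 a a"
  by (simp add: skew_def)

lemma skew_mult_right:
  assumes "skew c a b" "skew d a b'"
  shows "skew (c * d) a (b * b')"
proof -
  have "a * (b * b') \<doteq> scal c * (b * a) * b'"
    using cong_right[OF assms(1)[unfolded skew_def], of b'] by (simp add: mult.assoc)
  also have "scal c * (b * a) * b' = scal c * b * (a * b')" by (simp add: mult.assoc)
  also have "\<dots> \<doteq> scal c * b * (scal d * (b' * a))"
    using assms(2) unfolding skew_def by (rule cong_left)
  also have "\<dots> = scal (c * d) * (b * b' * a)"
    by (simp add: mult.assoc scal_mult scal_left_comm[of b])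
  finally show ?thesis unfolding skew_def .
qed

lemma skew_mult_left:
  assumes "skew c a b" "skew d a' b"
  shows "skew (c * d) (a * a') b"
proof -
  have "a * a' * b \<doteq> a * (scal d * (b * a'))"
    using cong_left[OF assms(2)[unfolded skew_def], of a] by (simp add: mult.assoc)
  also have "\<dots> = scal d * (a * b * a')" by (simp add: mult.assoc scal_left_comm[of a])
  also have "\<dots> \<doteq> scal d * (scal c * (b * a) * a')"
    using assms(1) unfolding skew_def by (intro cong_left cong_right)
  also have "\<dots> = scal (c * d) * (b * (a * a'))"
    by (simp add: mult.assoc scal_mult scal_left_comm[of "scal d"])
  finally show ?thesis unfolding skew_def .
qed

lemma skew_power_right: "skew c a b \<Longrightarrow> skew (c ^ n) a (b ^ n)"
  by (induction n) (use skew_scal(1)[of a 1] in \<open>auto intro: skew_mult_right\<close>)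

lemma skew_power_left: "skew c a b \<Longrightarrow> skew (c ^ n) (a ^ n) b"
  by (induction n) (use skew_scal(2)[of 1 b] in \<open>auto intro: skew_mult_left\<close>)

lemma skew_minus_right: "\<lbrakk>skew c a b; skew c a b'\<rbrakk> \<Longrightarrow> skew c a (b - b')"
  unfolding skew_def by (drule (1) cong_minus) (simp add: algebra_simps)

lemma skew_sym:
  assumes "skew c a b" "c \<noteq> 0"
  shows "skew (inverse c) b a"
  using cong_left[OF cong_sym[OF assms(1)[unfolded skew_def]], of "scal (inverse c)"] assms(2)
  by (simp add: skew_def scal_inverse_cancel)

lemma rel_xy: "Fx * Fy \<doteq> scal p * (Fy * Fx) + 1"
  and skew_st: "skew q Fs Ft"
  and skew_sx: "skew lam Fs Fx"
  and skew_sy: "skew (inverse lam) Fs Fy"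
  and skew_tx: "skew mu Ft Fx"
  and skew_ty: "skew (inverse mu) Ft Fy"
  using rels_in_W by (simp_all add: weyl_rels_def cong_def skew_def mult.assoc diff_diff_eq)

text \<open>If \<open>r\<close> denotes the relation \<open>x y - p y x - 1\<close>, then \<open>x z - p z x = x r - r x\<close>; similarly
  \<open>z y - p y z = r y - y r\<close> below.\<close>

lemma skew_xz: "skew p Fx Fz"
proof -
  let ?r = "Fx * Fy - scal p * (Fy * Fx) - 1"
  have r: "?r \<in> W" using rel_xy by (simp add: cong_def diff_diff_eq)
  have "Fx * ?r - ?r * Fx \<in> W" by (rule W_minus[OF W_left[OF r] W_right[OF r]])
  also have "Fx * ?r - ?r * Fx = Fx * Fz - scal p * (Fz * Fx)"
    by (simp add: Fz_def algebra_simps scal_left_comm[of Fx])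
  finally show ?thesis by (simp add: skew_def cong_def)
qed

lemma skew_yz: "skew (inverse p) Fy Fz"
proof -
  let ?r = "Fx * Fy - scal p * (Fy * Fx) - 1"
  have r: "?r \<in> W" using rel_xy by (simp add: cong_def diff_diff_eq)
  have "?r * Fy - Fy * ?r \<in> W" by (rule W_minus[OF W_right[OF r] W_left[OF r]])
  also have "?r * Fy - Fy * ?r = Fz * Fy - scal p * (Fy * Fz)"
    by (simp add: Fz_def algebra_simps scal_left_comm[of Fy])
  finally have "skew p Fz Fy" by (simp add: skew_def cong_def)
  thus ?thesis using skew_sym nz by blast
qed

lemma skew_sz: "skew 1 Fs Fz"
  using skew_mult_right[OF skew_sx skew_sy] skew_mult_right[OF skew_sy skew_sx] nz
  by (simp add: Fz_def skew_minus_right)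

lemma skew_tz: "skew 1 Ft Fz"
  using skew_mult_right[OF skew_tx skew_ty] skew_mult_right[OF skew_ty skew_tx] nz
  by (simp add: Fz_def skew_minus_right)

lemma z_eq: "Fz \<doteq> scal (p - 1) * (Fy * Fx) + 1"
  using cong_minus[OF rel_xy, of "Fy * Fx" "Fy * Fx"] by (simp add: Fz_def algebra_simps scal_minus)

lemma yx_eq: "scal (p - 1) * (Fy * Fx) \<doteq> Fz - 1"
  using cong_minus[OF cong_sym[OF z_eq] cong_refl, of 1] by simp

lemma xy_eq: "scal (p - 1) * (Fx * Fy) \<doteq> scal p * Fz - 1"
proof -
  have "scal (p - 1) * (Fx * Fy) \<doteq> scal (p - 1) * (scal p * (Fy * Fx) + 1)"
    by (rule cong_left[OF rel_xy])
  also have "\<dots> = scal p * (scal (p - 1) * (Fy * Fx)) + scal (p - 1)"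
    by (simp add: distrib_left scal_left_comm[of "scal p"])
  also have "\<dots> \<doteq> scal p * (Fz - 1) + scal (p - 1)"
    by (intro cong_add cong_left yx_eq cong_refl)
  also have "\<dots> = scal p * Fz - 1" by (simp add: algebra_simps scal_minus)
  finally show ?thesis .
qed

section \<open>Normal elements\<close>

text \<open>It is enough to know how \<open>\<sigma>\<close> commutes with the variables: since rescaling is multiplicative, \<open>\<sigma>\<close> then
  moves past every element (\<open>normal_twist\<close>).\<close>

definition normal_with :: "(gen \<Rightarrow> 'k) \<Rightarrow> (gen, 'k) free_algebra \<Rightarrow> bool" where
  "normal_with \<kappa> \<sigma> \<longleftrightarrow> (\<forall>g. skew (\<kappa> g) \<sigma> (fvar g))"

lemma normal_twist:
  assumes "normal_with \<kappa> \<sigma>"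
  shows "\<sigma> * f \<doteq> twist \<kappa> f * \<sigma>"
proof (induction f rule: free_algebra_induct)
  case (scal c)
  show ?case by (simp add: scal_comm)
next
  case (var g)
  show ?case using assms by (simp add: normal_with_def skew_def mult.assoc)
next
  case (add f g)
  show ?case using cong_add[OF add] by (simp add: algebra_simps twist_add)
next
  case (mult f g)
  have "\<sigma> * f * g \<doteq> twist \<kappa> f * \<sigma> * g" by (rule cong_right[OF mult(1)])
  also have "\<dots> \<doteq> twist \<kappa> f * (twist \<kappa> g * \<sigma>)" unfolding mult.assoc by (rule cong_left[OF mult(2)])
  finally show ?case by (simp add: twist_mult mult.assoc)
qed

text \<open>All relations are homogeneous if \<open>x\<close> and \<open>y\<close> have inverse weights: the constant term of
  \<open>x y - p y x - 1\<close> then has the weight of \<open>x y\<close>. So rescaling multiplies each relation by a scalar.\<close>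

lemma twist_W:
  assumes "\<kappa> Gx * \<kappa> Gy = 1" "f \<in> W"
  shows "twist \<kappa> f \<in> W"
proof -
  have xy: "scal (\<kappa> Gx) * Fx * (scal (\<kappa> Gy) * Fy) = Fx * Fy"
    "scal (\<kappa> Gy) * Fy * (scal (\<kappa> Gx) * Fx) = Fy * Fx"
    using assms(1) by (simp_all add: scal_mult_scal mult.commute[of "\<kappa> Gy"])
  have gh: "twist \<kappa> (fvar g * fvar h - scal c * fvar h * fvar g)
    = scal (\<kappa> g * \<kappa> h) * (fvar g * fvar h - scal c * fvar h * fvar g)" for g h c
  proof -
    have "twist \<kappa> (fvar g * fvar h - scal c * fvar h * fvar g)
      = scal (\<kappa> g * \<kappa> h) * (fvar g * fvar h) - scal c * (scal (\<kappa> g * \<kappa> h) * (fvar h * fvar g))"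
      by (simp add: twist_minus twist_mult mult.assoc[of "scal c"] scal_mult_scal mult.commute[of "\<kappa> h"])
    thus ?thesis
      by (simp only: scal_left_comm[of "scal c"] mult.assoc[of "scal c"] right_diff_distrib)
  qed
  have "W \<subseteq> {f. twist \<kappa> f \<in> W}"
  proof (rule W_least)
    have r: "twist \<kappa> (fvar g * fvar h - scal c * fvar h * fvar g) \<in> W"
      if "fvar g * fvar h - scal c * fvar h * fvar g \<in> weyl_rels p q lam mu" for g h c
      unfolding gh using that rels_in_W by (blast intro: W_left)
    have "twist \<kappa> (Fx * Fy - scal p * Fy * Fx - 1) = Fx * Fy - scal p * Fy * Fx - 1"
      by (simp add: twist_minus twist_mult xy mult.assoc[of "scal p"])
    moreover have "Fx * Fy - scal p * Fy * Fx - 1 \<in> W"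
      using rels_in_W by (simp add: weyl_rels_def)
    ultimately have "twist \<kappa> (Fx * Fy - scal p * Fy * Fx - 1) \<in> W" by simp
    with r show "weyl_rels p q lam mu \<subseteq> {f. twist \<kappa> f \<in> W}"
      by (simp add: weyl_rels_def)
  qed (auto simp: W_zero W_add W_left W_right twist_add twist_mult)
  thus ?thesis using assms(2) by blast
qed

definition smono :: "'k \<Rightarrow> nat \<Rightarrow> nat \<Rightarrow> nat \<Rightarrow> (gen, 'k) free_algebra" where
  "smono c i j k = scal c * Fz ^ i * Fs ^ j * Ft ^ k"

text \<open>The scalar by which the monomial \<open>z\<^sup>i s\<^sup>j t\<^sup>k\<close> commutes with a variable.\<close>

fun wt :: "nat \<Rightarrow> nat \<Rightarrow> nat \<Rightarrow> gen \<Rightarrow> 'k" where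
  "wt i j k Gx = inverse p ^ i * lam ^ j * mu ^ k"
| "wt i j k Gy = p ^ i * inverse lam ^ j * inverse mu ^ k"
| "wt i j k Gs = inverse q ^ k"
| "wt i j k Gt = q ^ j"

lemma wt_xy: "wt i j k Gx * wt i j k Gy = 1"
  using nz by (simp add: field_simps)

lemma skew_smono:
  assumes "skew a Fz b" "skew a' Fs b" "skew a'' Ft b"
  shows "skew (a ^ i * a' ^ j * a'' ^ k) (smono c i j k) b"
  unfolding smono_def
  using skew_mult_left[OF skew_mult_left[OF skew_mult_left[OF skew_scal(2)[of c b]
      skew_power_left[OF assms(1)]] skew_power_left[OF assms(2)]] skew_power_left[OF assms(3)]]
  by simp

lemma normal_smono: "normal_with (wt i j k) (smono c i j k)"
  unfolding normal_with_def
proof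
  fix g
  have zx: "skew (inverse p) Fz Fx" by (rule skew_sym[OF skew_xz nz(1)])
  have zy: "skew p Fz Fy" using skew_sym[OF skew_yz] nz by simp
  have zs: "skew 1 Fz Fs" "skew 1 Fz Ft" using skew_sym[OF skew_sz] skew_sym[OF skew_tz] by simp_all
  have ts: "skew (inverse q) Ft Fs" by (rule skew_sym[OF skew_st nz(2)])
  show "skew (wt i j k g) (smono c i j k) (fvar g)"
    using skew_smono[OF zx skew_sx skew_tx, of i j k c] skew_smono[OF zy skew_sy skew_ty, of i j k c]
      skew_smono[OF zs(1) skew_self ts, of i j k c] skew_smono[OF zs(2) skew_st skew_self, of i j k c]
    by (cases g) simp_all
qed

lemma twist_smono:
  assumes "\<kappa> Gx * \<kappa> Gy = 1"
  shows "twist \<kappa> (smono c i j k) = scal (\<kappa> Gs ^ j * \<kappa> Gt ^ k) * smono c i j k"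
proof -
  have z: "twist \<kappa> Fz = Fz"
    using assms by (simp add: Fz_def twist_minus twist_mult scal_mult_scal mult.commute[of "\<kappa> Gy"])
  have pw: "(scal a * f) ^ n = scal (a ^ n) * f ^ n" for a n and f :: "(gen, 'k) free_algebra"
    by (induction n) (simp_all add: scal_mult_scal)
  have "twist \<kappa> (smono c i j k)
    = (scal c * Fz ^ i) * ((scal (\<kappa> Gs ^ j) * Fs ^ j) * (scal (\<kappa> Gt ^ k) * Ft ^ k))"
    by (simp add: smono_def twist_mult twist_power z pw mult.assoc[of "scal c * Fz ^ i"])
  also have "\<dots> = scal (\<kappa> Gs ^ j * \<kappa> Gt ^ k) * ((scal c * Fz ^ i) * (Fs ^ j * Ft ^ k))"
    unfolding scal_mult_scal[of "\<kappa> Gs ^ j"] by (rule scal_left_comm)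
  finally show ?thesis by (simp add: smono_def mult.assoc)
qed

lemma smono_mult:
  "smono c i j k * smono c' i' j' k' \<doteq> smono (c * c' * inverse q ^ (k * j')) (i + i') (j + j') (k + k')"
proof -
  have 1: "skew 1 (Fs ^ j * Ft ^ k) (Fz ^ i')"
    using skew_power_right[OF skew_mult_left[OF skew_power_left[OF skew_sz] skew_power_left[OF skew_tz]]]
    by simp
  have 2: "skew (inverse q ^ (k * j')) (Ft ^ k) (Fs ^ j')"
    using skew_power_right[OF skew_power_left[OF skew_sym[OF skew_st nz(2)]]]
    by (simp add: power_mult)
  let ?u = "scal c * (scal c' * Fz ^ i)"
  have "smono c i j k * smono c' i' j' k'
    = ?u * ((Fs ^ j * Ft ^ k) * Fz ^ i') * (Fs ^ j' * Ft ^ k')"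
    unfolding smono_def mult.assoc
    by (simp only: scal_left_comm[of "Fz ^ i"] scal_left_comm[of "Fs ^ j"] scal_left_comm[of "Ft ^ k"])
  also have "\<dots> \<doteq> ?u * (scal 1 * (Fz ^ i' * (Fs ^ j * Ft ^ k))) * (Fs ^ j' * Ft ^ k')"
    using 1 unfolding skew_def by (intro cong_left cong_right)
  also have "\<dots> = (?u * Fz ^ i' * Fs ^ j) * (Ft ^ k * Fs ^ j') * Ft ^ k'"
    by (simp add: mult.assoc)
  also have "\<dots> \<doteq> (?u * Fz ^ i' * Fs ^ j) * (scal (inverse q ^ (k * j')) * (Fs ^ j' * Ft ^ k)) * Ft ^ k'"
    using 2 unfolding skew_def by (intro cong_left cong_right)
  also have "\<dots> = smono (c * c' * inverse q ^ (k * j')) (i + i') (j + j') (k + k')"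
    unfolding smono_def mult.assoc
    by (simp only: mult.assoc scal_mult power_add scal_left_comm[of "Fz ^ _"] scal_left_comm[of "Fs ^ _"])
  finally show ?thesis .
qed

text \<open>Rescaling by the weights of the denominator \<open>\<sigma>\<close> turns \<open>f \<sigma> = 0\<close> into \<open>f' \<sigma> = 0\<close>, up to a nonzero
  scalar, where \<open>f'\<close> is the rescaled \<open>f\<close>; but \<open>f' \<sigma> = \<sigma> f\<close>.\<close>

lemma smono_reversible:
  assumes "f * smono c i j k \<in> W"
  shows "smono c i j k * f \<in> W"
proof -
  let ?k = "wt i j k" and ?s = "smono c i j k"
  let ?d = "?k Gs ^ j * ?k Gt ^ k"
  have "twist ?k f * (scal ?d * ?s) \<in> W"
    using twist_W[of ?k, OF wt_xy assms]
    by (simp only: twist_mult twist_smono[of ?k, OF wt_xy])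
  hence "scal (inverse ?d) * (scal ?d * (twist ?k f * ?s)) \<in> W"
    unfolding scal_left_comm[of "twist ?k f"] by (rule W_left)
  moreover have d: "?d \<noteq> 0" using nz by simp
  ultimately have "twist ?k f * ?s \<in> W" by (metis scal_inverse_cancel[OF d])
  thus ?thesis
    using normal_twist[OF normal_smono[of i j k c], of f] W_add[of "?s * f - twist ?k f * ?s" "twist ?k f * ?s"]
    by (simp add: cong_def)
qed

section \<open>A module on which no denominator vanishes\<close>

text \<open>The \<open>p\<close>-Weyl algebra generated by \<open>x\<close> and \<open>y\<close> acts by weighted shifts in the first argument. With \<open>x\<close>
  the plain shift,   the coefficients \<open>b\<^sub>n\<close> of \<open>y\<close> must satisfy \<open>-p b\<^sub>0 = 1\<close> and \<open>b\<^bsub>n-1\<^esub> - p b\<^sub>n = 1\<close>, whose solution is the negative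
  geometric sum below; \<open>z\<close> then multiplies by \<open>b\<^bsub>n-1\<^esub> - b\<^sub>n = p\<^bsup>-(n+1)\<^esup>\<close>. The second argument is there
  for \<open>s\<close> and \<open>t\<close>, which have to commute up to \<open>q\<close>.\<close>

fun act_var :: "gen \<Rightarrow> (nat \<Rightarrow> nat \<Rightarrow> 'k) \<Rightarrow> nat \<Rightarrow> nat \<Rightarrow> 'k" where
  "act_var Gx v n j = (if n = 0 then 0 else v (n - 1) j)"
| "act_var Gy v n j = - (\<Sum>i\<le>n. inverse p ^ Suc i) * v (Suc n) j"
| "act_var Gs v n j = lam ^ n * v n (Suc j)"
| "act_var Gt v n j = mu ^ n * q ^ j * v n j"

fun act_word :: "gen word \<Rightarrow> (nat \<Rightarrow> nat \<Rightarrow> 'k) \<Rightarrow> nat \<Rightarrow> nat \<Rightarrow> 'k" where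
  "act_word (Word ws) v = foldr act_var ws v"

definition act :: "(gen, 'k) free_algebra \<Rightarrow> (nat \<Rightarrow> nat \<Rightarrow> 'k) \<Rightarrow> nat \<Rightarrow> nat \<Rightarrow> 'k" where
  "act f v n j = (\<Sum>w\<in>Poly_Mapping.keys f. Poly_Mapping.lookup f w * act_word w v n j)"

lemma act_word_add: "act_word (u + w) v = act_word u (act_word w v)"
  by (cases u; cases w) simp

lemma act_var_linear:
  "act_var g (\<lambda>n j. a * u n j + b * v n j) = (\<lambda>n j. a * act_var g u n j + b * act_var g v n j)"
  by (cases g) (auto simp: fun_eq_iff algebra_simps)

lemma act_word_linear:
  "act_word w (\<lambda>n j. a * u n j + b * v n j) = (\<lambda>n j. a * act_word w u n j + b * act_word w v n j)"
proof -
  obtain ws where "w = Word ws" by (cases w)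
  thus ?thesis by (induction ws arbitrary: w) (simp_all add: act_var_linear)
qed

lemma act_single: "act (Poly_Mapping.single w c) v n j = c * act_word w v n j"
  by (cases "c = 0") (simp_all add: act_def)

lemma act_add: "act (f + g) v n j = act f v n j + act g v n j"
  unfolding act_def by (rule setsum_keys_plus_distrib) (simp_all add: distrib_right)

lemma act_scal [simp]: "act (scal c) v = (\<lambda>n j. c * v n j)"
  by (simp add: fun_eq_iff scal_def act_single zero_word_def)

lemma act_0 [simp]: "act 0 v = (\<lambda>n j. 0)" and act_1 [simp]: "act 1 v = v"
  using act_scal[of 0 v] act_scal[of 1 v] by simp_all

lemma act_minus: "act (f - g) v n j = act f v n j - act g v n j"
  using act_add[of "f - g" g v n j] by simp

lemma act_fvar [simp]: "act (fvar g) v = act_var g v"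
  by (simp add: fun_eq_iff fvar_def act_single)

lemma act_mult: "act (f * g) v = act f (act g v)"
proof (induction f rule: single_induct)
  case (single u a)
  have "act (Poly_Mapping.single u a * g) v = (\<lambda>n j. a * act_word u (act g v) n j)"
  proof (induction g rule: single_induct)
    case (single w b)
    have single: "act (Poly_Mapping.single w b) v = (\<lambda>n j. b * act_word w v n j)"
      by (simp add: fun_eq_iff act_single)
    have "act_word u (\<lambda>n j. b * act_word w v n j) = (\<lambda>n j. b * act_word u (act_word w v) n j)"
      using act_word_linear[of u b "act_word w v" 0 "act_word w v"] by simp
    thus ?case unfolding single by (simp add: fun_eq_iff mult_single act_single act_word_add)
  next
    case (add f g)
    have sum: "act (f + g) v = (\<lambda>n j. act f v n j + act g v n j)"
      by (simp add: fun_eq_iff act_add)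
    have "act_word u (\<lambda>n j. act f v n j + act g v n j)
      = (\<lambda>n j. act_word u (act f v) n j + act_word u (act g v) n j)"
      using act_word_linear[of u 1 "act f v" 1 "act g v"] by simp
    thus ?case using add unfolding sum by (simp add: fun_eq_iff distrib_left act_add)
  qed
  thus ?case by (simp add: fun_eq_iff act_single)
next
  case (add f g)
  thus ?case by (simp add: fun_eq_iff distrib_right act_add)
qed

lemma act_linear:
  "act f (\<lambda>n j. a * u n j + b * v n j) n j = a * act f u n j + b * act f v n j"
  by (simp add: act_def act_word_linear algebra_simps sum.distrib sum_distrib_left)

lemma act_zero_vector: "act f (\<lambda>n j. 0) = (\<lambda>n j. 0)"
  using act_linear[of f 0 "\<lambda>n j. 0" 0 "\<lambda>n j. 0"] by (simp add: fun_eq_iff)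

lemma act_W:
  assumes "f \<in> W"
  shows "act f v = (\<lambda>n j. 0)"
proof -
  have "W \<subseteq> {f. \<forall>v. act f v = (\<lambda>n j. 0)}"
  proof (rule W_least)
    have xy: "act (Fx * Fy - scal p * Fy * Fx - 1) v n j = 0" for v n j
    proof (cases n)
      case 0
      show ?thesis using nz by (simp add: 0 act_minus act_mult)
    next
      case (Suc m)
      have "(\<Sum>i\<le>Suc m. inverse p ^ i) = 1 + (\<Sum>i\<le>m. inverse p ^ Suc i)"
        unfolding sum.atMost_Suc_shift by simp
      moreover have "p * (\<Sum>i\<le>Suc m. inverse p ^ Suc i) = (\<Sum>i\<le>Suc m. inverse p ^ i)"
        unfolding sum_distrib_left using nz by (intro sum.cong) auto
      ultimately have "p * (\<Sum>i\<le>Suc m. inverse p ^ Suc i) = 1 + (\<Sum>i\<le>m. inverse p ^ Suc i)"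
        by simp
      hence eq: "p * ((\<Sum>i\<le>Suc m. inverse p ^ Suc i) * v n j) = (1 + (\<Sum>i\<le>m. inverse p ^ Suc i)) * v n j"
        by (simp only: mult.assoc[symmetric])
      have "act (Fx * Fy - scal p * Fy * Fx - 1) v n j
        = - (\<Sum>i\<le>m. inverse p ^ Suc i) * v n j + p * ((\<Sum>i\<le>Suc m. inverse p ^ Suc i) * v n j) - v n j"
        by (simp add: Suc act_minus act_mult del: sum.atMost_Suc)
      thus ?thesis unfolding eq by (simp add: distrib_right del: sum.atMost_Suc)
    qed
    show "weyl_rels p q lam mu \<subseteq> {f. \<forall>v. act f v = (\<lambda>n j. 0)}"
      using nz
      by (auto simp: weyl_rels_def fun_eq_iff xy)
        (auto simp: act_minus act_mult gr0_conv_Suc)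
  next
    fix f g assume "f \<in> {f. \<forall>v. act f v = (\<lambda>n j. 0)}" "g \<in> {f. \<forall>v. act f v = (\<lambda>n j. 0)}"
    thus "f + g \<in> {f. \<forall>v. act f v = (\<lambda>n j. 0)}" by (simp add: fun_eq_iff act_add)
  qed (simp_all add: act_mult act_zero_vector)
  thus ?thesis using assms by blast
qed

definition nowhere_zero :: "(nat \<Rightarrow> nat \<Rightarrow> 'k) \<Rightarrow> bool" where
  "nowhere_zero v \<longleftrightarrow> (\<forall>n j. v n j \<noteq> 0)"

lemma act_z: "act Fz v n j = inverse p ^ Suc n * v n j"
  by (cases n) (simp_all add: Fz_def act_minus act_mult algebra_simps)

lemma nowhere_zero_act_power:
  assumes "\<And>v. nowhere_zero v \<Longrightarrow> nowhere_zero (act f v)" "nowhere_zero v"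
  shows "nowhere_zero (act (f ^ n) v)"
  using assms(2) by (induction n) (simp_all add: act_mult assms(1))

text \<open>The constant function \<open>1\<close> is mapped by the denominator to a function without zeros.\<close>

lemma smono_notin_W:
  assumes "c \<noteq> 0"
  shows "smono c i j k \<notin> W"
proof
  assume "smono c i j k \<in> W"
  moreover have "nowhere_zero (act (smono c i j k) (\<lambda>n j. 1))"
  proof -
    have Z: "nowhere_zero (act Fz v)" and S: "nowhere_zero (act Fs v)" and T: "nowhere_zero (act Ft v)"
      and C: "nowhere_zero (act (scal c) v)" if "nowhere_zero v" for v
      using that nz assms by (simp_all add: nowhere_zero_def act_z)
    show ?thesis
      unfolding smono_def act_mult
      by (intro C nowhere_zero_act_power Z S T) (simp_all add: nowhere_zero_def)
  qed
  ultimately show False by (simp add: act_W nowhere_zero_def)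
qed

section \<open>Ordered monomials span\<close>

text \<open>The element written \<open>X\<^sup>d\<close> in the introduction.\<close>

definition xpow :: "int \<Rightarrow> (gen, 'k) free_algebra" where
  "xpow d = (if 0 \<le> d then Fx ^ nat d else Fy ^ nat (- d))"

fun omono :: "nat \<times> int \<times> nat \<times> nat \<Rightarrow> (gen, 'k) free_algebra" where
  "omono (i, d, j, k) = Fz ^ i * xpow d * (Fs ^ j * Ft ^ k)"

definition spanned :: "(gen, 'k) free_algebra \<Rightarrow> bool" where
  "spanned f \<longleftrightarrow> (\<exists>F c. finite F \<and> f \<doteq> (\<Sum>m\<in>F. scal (c m) * omono m))"

lemma spanned_cong: "\<lbrakk>f \<doteq> g; spanned g\<rbrakk> \<Longrightarrow> spanned f"
  unfolding spanned_def by (blast intro: cong_trans)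

lemma spanned_mono: "spanned (omono m)"
  unfolding spanned_def by (rule exI[of _ "{m}"], rule exI[of _ "\<lambda>_. 1"]) simp

lemma spanned_0: "spanned 0"
  unfolding spanned_def by (rule exI[of _ "{}"]) simp

lemma spanned_scal:
  assumes "spanned f" shows "spanned (scal a * f)"
proof -
  obtain F c where F: "finite F" "f \<doteq> (\<Sum>m\<in>F. scal (c m) * omono m)"
    using assms unfolding spanned_def by blast
  have "scal a * f \<doteq> (\<Sum>m\<in>F. scal (a * c m) * omono m)"
    using cong_left[OF F(2), of "scal a"] by (simp add: sum_distrib_left scal_mult mult.assoc)
  thus ?thesis unfolding spanned_def using F(1) by (intro exI conjI)
qed

lemma spanned_add:
  assumes "spanned f" "spanned g" shows "spanned (f + g)"
proof -
  obtain F c where F: "finite F" "f \<doteq> (\<Sum>m\<in>F. scal (c m) * omono m)"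
    using assms unfolding spanned_def by blast
  obtain G d where G: "finite G" "g \<doteq> (\<Sum>m\<in>G. scal (d m) * omono m)"
    using assms unfolding spanned_def by blast
  let ?c = "\<lambda>m. (if m \<in> F then c m else 0) + (if m \<in> G then d m else 0)"
  have "(\<Sum>m\<in>F. scal (c m) * omono m) = (\<Sum>m\<in>F\<union>G. scal (if m \<in> F then c m else 0) * omono m)"
    using F(1) G(1) by (intro sum.mono_neutral_cong_left) auto
  moreover have "(\<Sum>m\<in>G. scal (d m) * omono m) = (\<Sum>m\<in>F\<union>G. scal (if m \<in> G then d m else 0) * omono m)"
    using F(1) G(1) by (intro sum.mono_neutral_cong_left) auto
  ultimately have "f + g \<doteq> (\<Sum>m\<in>F\<union>G. scal (?c m) * omono m)"
    using cong_add[OF F(2) G(2)] unfolding scal_add distrib_right sum.distrib by simp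
  thus ?thesis unfolding spanned_def using F(1) G(1) by (intro exI conjI) auto
qed

lemma spanned_left:
  assumes "\<And>m. spanned (h * omono m)" "spanned f"
  shows "spanned (h * f)"
proof -
  obtain F c where F: "finite F" "f \<doteq> (\<Sum>m\<in>F. scal (c m) * omono m)"
    using assms unfolding spanned_def by blast
  have "h * f \<doteq> (\<Sum>m\<in>F. scal (c m) * (h * omono m))"
    using cong_left[OF F(2), of h] by (simp add: sum_distrib_left scal_left_comm[of h])
  moreover have "spanned (\<Sum>m\<in>F. scal (c m) * (h * omono m))"
    using F(1) by (induction F) (auto intro: spanned_0 spanned_add spanned_scal assms(1))
  ultimately show ?thesis by (rule spanned_cong)
qed

lemma skew_xpow:
  assumes "skew c a Fx" "skew (inverse c) a Fy"
  shows "skew (c powi d) a (xpow d)"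
  using skew_power_right[OF assms(1), of "nat d"] skew_power_right[OF assms(2), of "nat (- d)"]
  by (simp add: xpow_def power_int_def)

lemma skew_through:
  assumes "skew c a (Fz ^ i)" "a * xpow d \<doteq> h * xpow d'"
  shows "a * omono (i, d, j, k) \<doteq> scal c * (Fz ^ i * (h * xpow d' * (Fs ^ j * Ft ^ k)))"
proof -
  have "a * omono (i, d, j, k) = (a * Fz ^ i) * xpow d * (Fs ^ j * Ft ^ k)"
    by (simp add: mult.assoc)
  also have "\<dots> \<doteq> (scal c * (Fz ^ i * a)) * xpow d * (Fs ^ j * Ft ^ k)"
    using assms(1) unfolding skew_def by (intro cong_right)
  also have "\<dots> = scal c * Fz ^ i * (a * xpow d) * (Fs ^ j * Ft ^ k)"
    by (simp add: mult.assoc)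
  also have "\<dots> \<doteq> scal c * Fz ^ i * (h * xpow d') * (Fs ^ j * Ft ^ k)"
    by (intro cong_right cong_left assms(2))
  finally show ?thesis by (simp add: mult.assoc)
qed

lemma spanned_linear_in_z:
  "spanned (scal c * (Fz ^ i * ((scal a * Fz + scal b) * xpow d * (Fs ^ j * Ft ^ k))))"
proof -
  have "Fz ^ i * ((scal a * Fz + scal b) * xpow d * (Fs ^ j * Ft ^ k))
    = scal a * omono (Suc i, d, j, k) + scal b * omono (i, d, j, k)"
    by (simp add: algebra_simps scal_left_comm[of "Fz ^ i"] power_commutes)
      (simp add: mult.assoc[symmetric] power_commutes)
  thus ?thesis by (simp only: spanned_scal spanned_add spanned_mono)
qed

text \<open>Solving \<open>z = x y - y x\<close> together with \<open>x y = p y x + 1\<close> for the two products.\<close>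

lemma xy_linear_in_z:
  assumes "p \<noteq> 1"
  shows "Fx * Fy \<doteq> scal (inverse (p - 1) * p) * Fz + scal (- inverse (p - 1))"
    "Fy * Fx \<doteq> scal (inverse (p - 1)) * Fz + scal (- inverse (p - 1))"
proof -
  have neg: "scal (- a) = - scal a" for a :: 'k
    using scal_minus[of 0 a] by simp
  show "Fx * Fy \<doteq> scal (inverse (p - 1) * p) * Fz + scal (- inverse (p - 1))"
    using cong_left[OF xy_eq, of "scal (inverse (p - 1))"] assms
    by (simp add: scal_inverse_cancel right_diff_distrib scal_mult mult.assoc neg)
  show "Fy * Fx \<doteq> scal (inverse (p - 1)) * Fz + scal (- inverse (p - 1))"
    using cong_left[OF yx_eq, of "scal (inverse (p - 1))"] assms
    by (simp add: scal_inverse_cancel right_diff_distrib scal_mult mult.assoc neg)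
qed

text \<open>For \<open>d < 0\<close> the product begins with \<open>x y\<close>, a polynomial of degree one in \<open>z\<close>.\<close>

lemma x_times_xpow:
  assumes "p \<noteq> 1"
  shows "\<exists>a b. Fx * xpow d \<doteq> (scal a * Fz + scal b) * xpow (d + 1)"
proof (cases "0 \<le> d")
  case True
  hence "Fx * xpow d = (scal 0 * Fz + scal 1) * xpow (d + 1)"
    by (simp add: xpow_def nat_add_distrib)
  thus ?thesis by (metis cong_refl)
next
  case False
  hence n: "nat (- d) = Suc (nat (- (d + 1)))" by simp
  have xpow: "xpow d = Fy * xpow (d + 1)"
    using False n by (auto simp: xpow_def)
  show ?thesis
    unfolding xpow mult.assoc[symmetric] using cong_right[OF xy_linear_in_z(1)[OF assms]] by blast
qed

lemma y_times_xpow: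
  assumes "p \<noteq> 1"
  shows "\<exists>a b. Fy * xpow d \<doteq> (scal a * Fz + scal b) * xpow (d - 1)"
proof (cases "0 < d")
  case False
  hence "Fy * xpow d = (scal 0 * Fz + scal 1) * xpow (d - 1)"
    using Suc_nat_eq_nat_zadd1[of "- d"] by (cases "d = 0") (simp_all add: xpow_def flip: power_Suc)
  thus ?thesis by (metis cong_refl)
next
  case True
  hence n: "nat d = Suc (nat (d - 1))" by simp
  have xpow: "xpow d = Fx * xpow (d - 1)"
    using True n by (simp add: xpow_def)
  show ?thesis
    unfolding xpow mult.assoc[symmetric] using cong_right[OF xy_linear_in_z(2)[OF assms]] by blast
qed

lemma skew_zi: "skew (p ^ i) Fx (Fz ^ i)" "skew (inverse p ^ i) Fy (Fz ^ i)"
  "skew 1 Fs (Fz ^ i)" "skew 1 Ft (Fz ^ i)"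
  using skew_power_right[OF skew_xz] skew_power_right[OF skew_yz]
    skew_power_right[OF skew_sz] skew_power_right[OF skew_tz] by simp_all

text \<open>The span of the ordered monomials contains \<open>1\<close> and is closed under left multiplication by
  each variable.\<close>

lemma spanned_all:
  assumes "p \<noteq> 1"
  shows "spanned f"
proof -
  have gen: "spanned (fvar g * omono m)" for g m
  proof -
    obtain i d j k where m: "m = (i, d, j, k)" by (cases m)
    show ?thesis
    proof (cases g)
      case Gx
      obtain a b where "Fx * xpow d \<doteq> (scal a * Fz + scal b) * xpow (d + 1)"
        using x_times_xpow[OF assms] by blast
      from skew_through[OF skew_zi(1) this] show ?thesis
        unfolding Gx m by (rule spanned_cong) (rule spanned_linear_in_z)
    next
      case Gy
      obtain a b where "Fy * xpow d \<doteq> (scal a * Fz + scal b) * xpow (d - 1)"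
        using y_times_xpow[OF assms] by blast
      from skew_through[OF skew_zi(2) this] show ?thesis
        unfolding Gy m by (rule spanned_cong) (rule spanned_linear_in_z)
    next
      case Gs
      have "skew (lam powi d) Fs (Fz ^ i * xpow d)"
        using skew_mult_right[OF skew_zi(3) skew_xpow[OF skew_sx skew_sy]] by simp
      hence "Fs * (Fz ^ i * xpow d) * (Fs ^ j * Ft ^ k) \<doteq> scal (lam powi d) * (Fz ^ i * xpow d * Fs) * (Fs ^ j * Ft ^ k)"
        unfolding skew_def by (rule cong_right)
      hence "Fs * omono m \<doteq> scal (lam powi d) * omono (i, d, Suc j, k)"
        by (simp add: m mult.assoc)
      thus ?thesis unfolding Gs using spanned_cong spanned_scal spanned_mono by blast
    next
      case Gt
      have "skew (mu powi d) Ft (Fz ^ i * xpow d)"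
        using skew_mult_right[OF skew_zi(4) skew_xpow[OF skew_tx skew_ty]] by simp
      moreover have "skew (inverse q ^ j) Ft (Fs ^ j)"
        by (rule skew_power_right[OF skew_sym[OF skew_st nz(2)]])
      ultimately have "skew (mu powi d * inverse q ^ j) Ft (Fz ^ i * xpow d * Fs ^ j)"
        by (rule skew_mult_right)
      from cong_right[OF this[unfolded skew_def], of "Ft ^ k"]
      have "Ft * omono m \<doteq> scal (mu powi d * inverse q ^ j) * omono (i, d, j, Suc k)"
        by (simp add: m mult.assoc)
      thus ?thesis unfolding Gt using spanned_cong spanned_scal spanned_mono by blast
    qed
  qed
  have "spanned (f * h)" if "spanned h" for h
    using that
  proof (induction f arbitrary: h rule: free_algebra_induct)
    case (scal c)
    thus ?case by (rule spanned_scal)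
  next
    case (var g)
    thus ?case by (rule spanned_left[OF gen])
  next
    case (add f g)
    thus ?case by (simp add: distrib_right spanned_add)
  next
    case (mult f g)
    thus ?case by (simp add: mult.assoc)
  qed
  from this[OF spanned_mono[of "(0, 0, 0, 0)"]] show ?thesis by (simp add: xpow_def)
qed

end

section \<open>Saturated ideals\<close>

lemma power_inj_of_not_root:
  fixes c :: "'k::field"
  assumes "c \<noteq> 0" "\<not> root_of_unity c" "c powi a = c powi b"
  shows "a = b"
proof -
  have *: "False" if "c powi a = c powi b" "b < a" for a b
  proof -
    have "c powi (a - b) = 1" using that assms(1) by (simp add: power_int_diff)
    hence "c ^ nat (a - b) = 1" using that by (simp add: power_int_def)
    moreover have "0 < nat (a - b)" using that by simp
    ultimately show False using assms(2) unfolding root_of_unity_def by blast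
  qed
  show ?thesis using *[of a b] *[of b a] assms(3) by (metis linorder_neqE_linordered_idom)
qed

text \<open>Preimages of ideals of the localization in the free algebra have these closure properties; the
  cancellation rules hold because \<open>z\<close>, \<open>s\<close> and \<open>t\<close> become invertible.\<close>

locale saturated_ideal = quantum_weyl p q lam mu for p q lam mu :: "'k::field" +
  fixes J :: "(gen, 'k) free_algebra set"
  assumes W_sub: "W \<subseteq> J"
    and J_add: "\<lbrakk>f \<in> J; g \<in> J\<rbrakk> \<Longrightarrow> f + g \<in> J"
    and J_left: "f \<in> J \<Longrightarrow> h * f \<in> J"
    and J_right: "f \<in> J \<Longrightarrow> f * h \<in> J"
    and J_cancel_left: "\<lbrakk>\<sigma> \<in> {Fz, Fs, Ft}; \<sigma> * f \<in> J\<rbrakk> \<Longrightarrow> f \<in> J"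
    and J_cancel_right: "\<lbrakk>\<sigma> \<in> {Fz, Fs, Ft}; f * \<sigma> \<in> J\<rbrakk> \<Longrightarrow> f \<in> J"
    and p_not_root: "\<not> root_of_unity p"
    and q_not_root: "\<not> root_of_unity q"
begin

lemma p_neq_1: "p \<noteq> 1"
  using p_not_root unfolding root_of_unity_def by (metis power_one zero_less_one)

lemma J_minus: "\<lbrakk>f \<in> J; g \<in> J\<rbrakk> \<Longrightarrow> f - g \<in> J"
  using J_add[of f "- 1 * g"] J_left[of g "- 1"] by simp

lemma J_cong: "\<lbrakk>f \<doteq> g; g \<in> J\<rbrakk> \<Longrightarrow> f \<in> J"
  using J_add[of "f - g" g] W_sub by (auto simp: cong_def)

lemma J_unscal: "\<lbrakk>scal c * f \<in> J; c \<noteq> 0\<rbrakk> \<Longrightarrow> f \<in> J"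
  using J_left[of "scal c * f" "scal (inverse c)"] by (simp add: scal_inverse_cancel)

lemma J_cancel_power_left:
  assumes "\<sigma> \<in> {Fz, Fs, Ft}" shows "\<sigma> ^ n * f \<in> J \<Longrightarrow> f \<in> J"
  by (induction n) (use J_cancel_left[OF assms] in \<open>auto simp: mult.assoc\<close>)

lemma J_cancel_power_right:
  assumes "\<sigma> \<in> {Fz, Fs, Ft}" shows "f * \<sigma> ^ n \<in> J \<Longrightarrow> f \<in> J"
  by (induction n)
    (use J_cancel_right[OF assms] in \<open>auto simp: mult.assoc[symmetric] power_Suc2 simp del: power_Suc\<close>)

text \<open>Combining \<open>\<sigma> u\<close> and \<open>u \<sigma>\<close> multiplies the component of \<open>u\<close> with eigenvalue \<open>\<kappa>\<close> by \<open>\<kappa> - a\<close>.\<close>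

lemma commutator_in_J:
  assumes "(\<Sum>m\<in>F. u m) \<in> J" "\<And>m. m \<in> F \<Longrightarrow> skew (\<kappa> m) \<sigma> (u m)"
  shows "(\<Sum>m\<in>F. scal (\<kappa> m - a) * u m) * \<sigma> \<in> J"
proof -
  have "\<sigma> * (\<Sum>m\<in>F. u m) - scal a * (\<Sum>m\<in>F. u m) * \<sigma> \<in> J"
    by (intro J_minus J_left J_right assms(1))
  moreover have "(\<Sum>m\<in>F. scal (\<kappa> m - a) * u m) * \<sigma> \<doteq> \<sigma> * (\<Sum>m\<in>F. u m) - scal a * (\<Sum>m\<in>F. u m) * \<sigma>"
  proof -
    have "(\<Sum>m\<in>F. scal (\<kappa> m - a) * u m) * \<sigma>
      = (\<Sum>m\<in>F. scal (\<kappa> m) * (u m * \<sigma>)) - scal a * (\<Sum>m\<in>F. u m) * \<sigma>"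
      by (simp add: sum_distrib_right sum_distrib_left scal_minus left_diff_distrib sum_subtractf mult.assoc)
    also have "\<dots> \<doteq> (\<Sum>m\<in>F. \<sigma> * u m) - scal a * (\<Sum>m\<in>F. u m) * \<sigma>"
      using assms(2) unfolding skew_def by (intro cong_minus cong_sum cong_refl) (blast intro: cong_sym)
    finally show ?thesis by (simp add: sum_distrib_left)
  qed
  ultimately show ?thesis using J_cong by blast
qed

text \<open>Applying the previous step with \<open>a\<close> running through all eigenvalues other than \<open>c\<close> kills
  everything but the component for \<open>c\<close>, which is multiplied by a nonzero scalar. The eigenvalues of
  different summands may coincide, so that several operators \<open>\<sigma>\<close> can be used one after the other.\<close>

lemma eigencomponent_in_J:
  assumes "finite F" "(\<Sum>m\<in>F. u m) \<in> J" "\<sigma> \<in> {Fz, Fs, Ft}"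
    and skew: "\<And>m. m \<in> F \<Longrightarrow> skew (\<kappa> m) \<sigma> (u m)"
  shows "(\<Sum>m\<in>{m\<in>F. \<kappa> m = c}. u m) \<in> J"
proof -
  have "(\<Sum>m\<in>F. scal (\<Prod>a\<in>C. \<kappa> m - a) * u m) \<in> J" if "finite C" for C
    using that
  proof (induction C)
    case empty
    show ?case using assms(2) by simp
  next
    case (insert b C)
    have "skew (\<kappa> m) \<sigma> (scal (\<Prod>a\<in>C. \<kappa> m - a) * u m)" if "m \<in> F" for m
      using skew_mult_right[OF skew_scal(1) skew[OF that]] by simp
    from J_cancel_right[OF assms(3) commutator_in_J[OF insert.IH this]]
    have "(\<Sum>m\<in>F. scal (\<kappa> m - b) * (scal (\<Prod>a\<in>C. \<kappa> m - a) * u m)) \<in> J" by blast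
    thus ?case using insert.hyps by (simp add: scal_mult mult.assoc)
  qed
  from this[of "\<kappa> ` F - {c}"] assms(1)
  have "(\<Sum>m\<in>F. scal (\<Prod>a\<in>\<kappa> ` F - {c}. \<kappa> m - a) * u m) \<in> J" by simp
  also have "(\<Sum>m\<in>F. scal (\<Prod>a\<in>\<kappa> ` F - {c}. \<kappa> m - a) * u m)
    = (\<Sum>m\<in>{m\<in>F. \<kappa> m = c}. scal (\<Prod>a\<in>\<kappa> ` F - {c}. c - a) * u m)"
  proof (rule sum.mono_neutral_cong_right[OF assms(1)])
    have "(\<Prod>a\<in>\<kappa> ` F - {c}. \<kappa> m - a) = 0" if "m \<in> F" "\<kappa> m \<noteq> c" for m
      by (rule prod_zero) (use assms(1) that in auto)
    thus "\<forall>m\<in>F - {m \<in> F. \<kappa> m = c}. scal (\<Prod>a\<in>\<kappa> ` F - {c}. \<kappa> m - a) * u m = 0"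
      by simp
  qed auto
  finally have "scal (\<Prod>a\<in>\<kappa> ` F - {c}. c - a) * (\<Sum>m\<in>{m\<in>F. \<kappa> m = c}. u m) \<in> J"
    by (simp add: sum_distrib_left)
  thus ?thesis by (rule J_unscal) (use assms(1) in auto)
qed

text \<open>This is for \<open>w = x\<close> and \<open>w = y\<close>, which cannot be cancelled as \<open>z\<close> can: each commutator deletes one
  term of the polynomial in \<open>z\<close> and leaves an additional factor \<open>w\<close>, so the exponent \<open>d\<close> varies in the
  induction.\<close>

lemma power_in_J:
  assumes "w * Fz \<doteq> scal \<kappa> * (Fz * w)" "\<And>a b. \<kappa> ^ a = \<kappa> ^ b \<Longrightarrow> a = (b::nat)"
    and "finite I" "I \<noteq> {}" "\<And>i. i \<in> I \<Longrightarrow> c i \<noteq> 0" "(\<Sum>i\<in>I. scal (c i) * (Fz ^ i * w ^ d)) \<in> J"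
  shows "\<exists>n. w ^ n \<in> J"
  using assms(3-)
proof (induction I arbitrary: c d rule: finite_ne_induct)
  case (singleton i)
  have "Fz ^ i * w ^ d \<in> J" using singleton J_unscal[of "c i"] by simp
  thus ?case using J_cancel_power_left[of Fz] by blast
next
  case (insert b I)
  have sk: "skew \<kappa> w Fz" using assms(1) by (simp add: skew_def)
  have "skew (\<kappa> ^ i) w (scal (c i) * (Fz ^ i * w ^ d))" for i
    using skew_mult_right[OF skew_scal(1) skew_mult_right[OF skew_power_right[OF sk] skew_power_right[OF skew_self]]]
    by simp
  from commutator_in_J[OF insert.prems(2) this, of "\<kappa> ^ b"]
  have "(\<Sum>i\<in>insert b I. scal (\<kappa> ^ i - \<kappa> ^ b) * (scal (c i) * (Fz ^ i * w ^ d))) * w \<in> J" .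
  also have "(\<Sum>i\<in>insert b I. scal (\<kappa> ^ i - \<kappa> ^ b) * (scal (c i) * (Fz ^ i * w ^ d))) * w
    = (\<Sum>i\<in>I. scal ((\<kappa> ^ i - \<kappa> ^ b) * c i) * (Fz ^ i * w ^ Suc d))"
    using insert.hyps by (simp add: sum_distrib_right scal_mult mult.assoc power_commutes)
  finally show ?case
    by (rule insert.IH[rotated]) (use insert.prems(1) insert.hyps assms(2) in auto)
qed

text \<open>Multiplied by \<open>p - 1\<close>, the sum becomes \<open>p\<^bsup>n+1\<^esup> - 1\<close>.\<close>

lemma p_integer_nonzero: "(\<Sum>i<Suc n. p ^ i) \<noteq> 0"
  using p_not_root power_diff_1_eq[of p "Suc n"] unfolding root_of_unity_def
  by (metis mult_zero_right right_minus_eq zero_less_Suc)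

text \<open>The \<open>p\<close>-analogue of the rule that commuting with \<open>y\<close> differentiates powers of \<open>x\<close>. For \<open>n = 0\<close> the
  truncated exponent \<open>n - 1\<close> is harmless, as its coefficient is the empty sum.\<close>

lemma x_power_y: "Fx ^ n * Fy \<doteq> scal (p ^ n) * (Fy * Fx ^ n) + scal (\<Sum>i<n. p ^ i) * Fx ^ (n - 1)"
proof (induction n)
  case (Suc n)
  have "Fx ^ Suc n * Fy = Fx * (Fx ^ n * Fy)" by (simp add: mult.assoc)
  also have "\<dots> \<doteq> Fx * (scal (p ^ n) * (Fy * Fx ^ n) + scal (\<Sum>i<n. p ^ i) * Fx ^ (n - 1))"
    by (rule cong_left[OF Suc])
  also have "\<dots> = scal (p ^ n) * ((Fx * Fy) * Fx ^ n) + scal (\<Sum>i<n. p ^ i) * Fx ^ n"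
    by (cases n) (simp_all add: distrib_left scal_left_comm[of Fx] mult.assoc)
  also have "\<dots> \<doteq> scal (p ^ n) * ((scal p * (Fy * Fx) + 1) * Fx ^ n) + scal (\<Sum>i<n. p ^ i) * Fx ^ n"
    by (intro cong_add cong_left cong_right rel_xy cong_refl)
  also have "\<dots> = scal (p ^ Suc n) * (Fy * Fx ^ Suc n) + scal (\<Sum>i<Suc n. p ^ i) * Fx ^ (Suc n - 1)"
    by (simp add: distrib_left distrib_right scal_add scal_mult mult.assoc scal_left_comm[of "scal p"])
  finally show ?case .
qed simp

lemma x_y_power: "Fx * Fy ^ n \<doteq> scal (p ^ n) * (Fy ^ n * Fx) + scal (\<Sum>i<n. p ^ i) * Fy ^ (n - 1)"
proof (induction n)
  case (Suc n)
  have "Fx * Fy ^ Suc n = (Fx * Fy ^ n) * Fy" by (simp add: mult.assoc power_commutes)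
  also have "\<dots> \<doteq> (scal (p ^ n) * (Fy ^ n * Fx) + scal (\<Sum>i<n. p ^ i) * Fy ^ (n - 1)) * Fy"
    by (rule cong_right[OF Suc])
  also have "\<dots> = scal (p ^ n) * (Fy ^ n * (Fx * Fy)) + scal (\<Sum>i<n. p ^ i) * Fy ^ n"
    by (cases n) (simp_all add: distrib_right mult.assoc power_commutes)
  also have "\<dots> \<doteq> scal (p ^ n) * (Fy ^ n * (scal p * (Fy * Fx) + 1)) + scal (\<Sum>i<n. p ^ i) * Fy ^ n"
    by (intro cong_add cong_left rel_xy cong_refl)
  also have "\<dots> = scal (p ^ Suc n) * (Fy ^ Suc n * Fx) + scal (\<Sum>i<Suc n. p ^ i) * Fy ^ (Suc n - 1)"
    by (simp add: distrib_left distrib_right scal_add scal_mult mult.assoc scal_left_comm[of "scal p"]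
        scal_left_comm[of "Fy ^ n"] power_commutes) (simp add: mult.assoc[symmetric] power_commutes)
  finally show ?case .
qed simp

lemma one_in_J_of_power:
  assumes "w \<in> {Fx, Fy}" "w ^ n \<in> J"
  shows "1 \<in> J"
  using assms(2)
proof (induction n)
  case (Suc n)
  have "scal (\<Sum>i<Suc n. p ^ i) * w ^ n \<in> J"
  proof (cases "w = Fx")
    case True
    have "Fx ^ Suc n * Fy - scal (p ^ Suc n) * (Fy * Fx ^ Suc n) \<in> J"
      using Suc.prems unfolding True by (intro J_minus J_left[of "_ * _"] J_left J_right)
    thus ?thesis unfolding True
    proof (rule J_cong[rotated])
      show "scal (\<Sum>i<Suc n. p ^ i) * Fx ^ n \<doteq> Fx ^ Suc n * Fy - scal (p ^ Suc n) * (Fy * Fx ^ Suc n)"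
        using cong_sym[OF cong_minus[OF x_power_y[of "Suc n"]
            cong_refl[of "scal (p ^ Suc n) * (Fy * Fx ^ Suc n)"]]]
        by (simp del: sum.lessThan_Suc power_Suc)
    qed
  next
    case False
    hence w: "w = Fy" using assms(1) by simp
    have "Fx * Fy ^ Suc n - scal (p ^ Suc n) * (Fy ^ Suc n * Fx) \<in> J"
      using Suc.prems unfolding w by (intro J_minus J_left J_right)
    thus ?thesis unfolding w
    proof (rule J_cong[rotated])
      show "scal (\<Sum>i<Suc n. p ^ i) * Fy ^ n \<doteq> Fx * Fy ^ Suc n - scal (p ^ Suc n) * (Fy ^ Suc n * Fx)"
        using cong_sym[OF cong_minus[OF x_y_power[of "Suc n"]
            cong_refl[of "scal (p ^ Suc n) * (Fy ^ Suc n * Fx)"]]]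
        by (simp del: sum.lessThan_Suc power_Suc)
    qed
  qed
  hence "w ^ n \<in> J" using J_unscal p_integer_nonzero by blast
  thus ?case by (rule Suc.IH)
qed simp

lemma skew_mono:
  "skew (inverse p powi d) Fz (omono (i, d, j, k))"
  "skew (lam powi d * q ^ k) Fs (omono (i, d, j, k))"
  "skew (mu powi d * inverse q ^ j) Ft (omono (i, d, j, k))"
proof -
  have zx: "skew (inverse p) Fz Fx" by (rule skew_sym[OF skew_xz nz(1)])
  have zy: "skew (inverse (inverse p)) Fz Fy" using skew_sym[OF skew_yz] nz by simp
  have zs: "skew 1 Fz Fs" "skew 1 Fz Ft" using skew_sym[OF skew_sz] skew_sym[OF skew_tz] by simp_all
  have ts: "skew (inverse q) Ft Fs" by (rule skew_sym[OF skew_st nz(2)])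
  have m: "skew (c powi d * (a ^ j * b ^ k)) \<sigma> (omono (i, d, j, k))"
    if "skew 1 \<sigma> Fz" "skew c \<sigma> Fx" "skew (inverse c) \<sigma> Fy" "skew a \<sigma> Fs" "skew b \<sigma> Ft" for c a b \<sigma>
    using skew_mult_right[OF skew_mult_right[OF skew_power_right[OF that(1)] skew_xpow[OF that(2,3)]]
        skew_mult_right[OF skew_power_right[OF that(4)] skew_power_right[OF that(5)]]] by simp
  show "skew (inverse p powi d) Fz (omono (i, d, j, k))"
    using m[OF skew_self zx zy zs] by simp
  show "skew (lam powi d * q ^ k) Fs (omono (i, d, j, k))"
    using m[OF skew_sz skew_sx skew_sy skew_self skew_st] by simp
  show "skew (mu powi d * inverse q ^ j) Ft (omono (i, d, j, k))"
    using m[OF skew_tz skew_tx skew_ty ts skew_self] by simp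
qed

text \<open>An element outside the relations has an expansion with at least one nonzero coefficient.
  Three eigenvalue projections, for \<open>z\<close>, \<open>s\<close> and \<open>t\<close> in this order, isolate the terms with the same
  \<open>d\<close>, \<open>k\<close> and \<open>j\<close> as a chosen one: the eigenvalues of \<open>s\<close> and \<open>t\<close> involve \<open>d\<close>, which must be fixed before
  them.\<close>

theorem saturated_ideal_trivial:
  assumes "f \<in> J" "f \<notin> W"
  shows "1 \<in> J"
proof -
  obtain F c where F: "finite F" "f \<doteq> (\<Sum>m\<in>F. scal (c m) * omono m)"
    using spanned_all[OF p_neq_1] unfolding spanned_def by blast
  define u where "u m = scal (c m) * omono m" for m
  define G where "G = {m\<in>F. c m \<noteq> 0}"
  have "(\<Sum>m\<in>F. scal (c m) * omono m) = (\<Sum>m\<in>G. u m)"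
    unfolding u_def G_def using F(1) by (intro sum.mono_neutral_cong_right) auto
  with F have G: "finite G" "f \<doteq> (\<Sum>m\<in>G. u m)" by (simp_all add: G_def)
  have "G \<noteq> {}" using G(2) assms(2) cong_zero_iff by auto
  then obtain i0 d j k where m0: "(i0, d, j, k) \<in> G" by (metis ex_in_conv prod_cases4)
  have in_J: "(\<Sum>m\<in>G. u m) \<in> J" by (rule J_cong[OF cong_sym[OF G(2)] assms(1)])
  have sk: "skew a \<sigma> (u m)" if "skew a \<sigma> (omono m)" for a \<sigma> m
    unfolding u_def using skew_mult_right[OF skew_scal(1) that] by simp
  define G1 where "G1 = {m\<in>G. fst (snd m) = d}"
  define G2 where "G2 = {m\<in>G1. snd (snd (snd m)) = k}"
  define G3 where "G3 = {m\<in>G2. fst (snd (snd m)) = j}"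
  have inj_q: "q ^ a = q ^ b \<Longrightarrow> a = b" for a b :: nat
    using power_inj_of_not_root[OF nz(2) q_not_root, of "int a" "int b"] by simp
  have fin: "finite G1" "finite G2" using G(1) by (simp_all add: G1_def G2_def)
  have J1: "(\<Sum>m\<in>G1. u m) \<in> J"
  proof -
    have eq: "G1 = {m\<in>G. inverse p powi fst (snd m) = inverse p powi d}"
      using power_inj_of_not_root[OF nz(1) p_not_root] by (auto simp: G1_def power_int_inverse)
    have "skew (inverse p powi fst (snd m)) Fz (u m)" for m
      by (cases m) (simp only: fst_conv snd_conv sk skew_mono)
    thus ?thesis
      unfolding eq by (intro eigencomponent_in_J[OF G(1) in_J, of Fz]) auto
  qed
  have J2: "(\<Sum>m\<in>G2. u m) \<in> J"
  proof -
    have eq: "G2 = {m\<in>G1. lam powi d * q ^ snd (snd (snd m)) = lam powi d * q ^ k}"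
      using inj_q nz by (auto simp: G2_def)
    have "skew (lam powi d * q ^ snd (snd (snd m))) Fs (u m)" if "m \<in> G1" for m
      using that by (cases m) (auto simp: G1_def simp del: omono.simps intro!: sk skew_mono)
    thus ?thesis
      unfolding eq by (intro eigencomponent_in_J[OF fin(1) J1, of Fs]) auto
  qed
  have J3: "(\<Sum>m\<in>G3. u m) \<in> J"
  proof -
    have eq: "G3 = {m\<in>G2. mu powi d * inverse q ^ fst (snd (snd m)) = mu powi d * inverse q ^ j}"
      using inj_q nz by (auto simp: G3_def power_inverse)
    have "skew (mu powi d * inverse q ^ fst (snd (snd m))) Ft (u m)" if "m \<in> G2" for m
      using that by (cases m) (auto simp: G1_def G2_def simp del: omono.simps intro!: sk skew_mono)
    thus ?thesis
      unfolding eq by (intro eigencomponent_in_J[OF fin(2) J2, of Ft]) auto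
  qed
  define I where "I = {i. (i, d, j, k) \<in> G}"
  have G3: "G3 = (\<lambda>i. (i, d, j, k)) ` I"
    unfolding G3_def G2_def G1_def I_def by force
  have finI: "finite I"
    unfolding I_def using finite_vimageI[OF G(1), of "\<lambda>i. (i, d, j, k)"] by (simp add: inj_on_def vimage_def)
  have "(\<Sum>m\<in>G3. u m) = (\<Sum>i\<in>I. u (i, d, j, k))"
    unfolding G3 by (subst sum.reindex) (auto simp: inj_on_def)
  also have "\<dots> = (\<Sum>i\<in>I. scal (c (i, d, j, k)) * (Fz ^ i * xpow d)) * Fs ^ j * Ft ^ k"
    by (simp add: u_def sum_distrib_right mult.assoc)
  finally have "(\<Sum>i\<in>I. scal (c (i, d, j, k)) * (Fz ^ i * xpow d)) * Fs ^ j * Ft ^ k \<in> J"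
    using J3 by simp
  hence I_J: "(\<Sum>i\<in>I. scal (c (i, d, j, k)) * (Fz ^ i * xpow d)) \<in> J"
    using J_cancel_power_right[of Fs] J_cancel_power_right[of Ft] by blast
  have I: "I \<noteq> {}" "\<And>i. i \<in> I \<Longrightarrow> c (i, d, j, k) \<noteq> 0"
    using m0 by (auto simp: I_def G_def)
  have inj: "p ^ a = p ^ b \<Longrightarrow> a = b" for a b :: nat
    using power_inj_of_not_root[OF nz(1) p_not_root, of "int a" "int b"] by simp
  show ?thesis
  proof (cases "0 \<le> d")
    case True
    have "\<exists>n. Fx ^ n \<in> J"
      by (rule power_in_J[where c = "\<lambda>i. c (i, d, j, k)" and d = "nat d",
            OF skew_xz[unfolded skew_def] inj finI I])
        (use I_J True in \<open>simp_all add: xpow_def\<close>)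
    thus ?thesis using one_in_J_of_power[of Fx] by blast
  next
    case False
    have "\<exists>n. Fy ^ n \<in> J"
      by (rule power_in_J[where c = "\<lambda>i. c (i, d, j, k)" and d = "nat (- d)",
            OF skew_yz[unfolded skew_def] _ finI I])
        (use I_J False inj in \<open>simp_all add: xpow_def power_inverse\<close>)
    thus ?thesis using one_in_J_of_power[of Fy] by blast
  qed
qed

end

section \<open>Simplicity of the localization\<close>

context quantum_weyl
begin

abbreviation "A \<equiv> weyl_alg p q lam mu"
abbreviation "cls \<equiv> weyl_class p q lam mu"
abbreviation "Den \<equiv> weyl_ore_set p q lam mu"

lemma carrier_A: "carrier A = range cls"
  by (auto simp: weyl_alg_def FactRing_def A_RCOSETS_def' weyl_class_def)

lemma cls_hom: "cls \<in> ring_hom Free A"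
  using ideal.rcos_ring_hom[OF ideal_weyl_ideal] by (simp add: weyl_alg_def weyl_class_def[abs_def])

lemma cls_simps:
  "cls f \<otimes>\<^bsub>A\<^esub> cls g = cls (f * g)" "cls f \<oplus>\<^bsub>A\<^esub> cls g = cls (f + g)" "\<one>\<^bsub>A\<^esub> = cls 1" "\<zero>\<^bsub>A\<^esub> = cls 0"
proof -
  show "cls f \<otimes>\<^bsub>A\<^esub> cls g = cls (f * g)" "cls f \<oplus>\<^bsub>A\<^esub> cls g = cls (f + g)" "\<one>\<^bsub>A\<^esub> = cls 1"
    using ring_hom_mult[OF cls_hom, of f g] ring_hom_add[OF cls_hom, of f g] ring_hom_one[OF cls_hom]
    by simp_all
  show "\<zero>\<^bsub>A\<^esub> = cls 0"
    using ring_hom_zero[OF cls_hom ring_Free ring_weyl_alg] by simp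
qed

lemma cls_eq_iff: "cls f = cls g \<longleftrightarrow> f \<doteq> g"
proof -
  interpret F: ring "Free :: (gen, 'k) free_algebra ring" by (rule ring_Free)
  have "\<ominus>\<^bsub>Free\<^esub> g = - g" by (rule F.minus_equality) simp_all
  hence "f \<ominus>\<^bsub>Free\<^esub> g = f - g" by (simp add: F.minus_eq)
  thus ?thesis
    using F.quotient_eq_iff_same_a_r_cos[OF ideal_weyl_ideal, of f g]
    by (simp add: weyl_class_def cong_def)
qed

lemma Den_eq: "Den = {cls (smono c i j k) | c i j k. c \<noteq> 0}"
  by (simp add: weyl_ore_set_def smono_def)

lemma smono_in_Den: "c \<noteq> 0 \<Longrightarrow> cls (smono c i j k) \<in> Den"
  unfolding Den_eq by blast

lemma left_denominator_set_Den: "left_denominator_set A Den"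
proof (intro left_denominator_set.intro left_denominator_set_axioms.intro ring_weyl_alg)
  show "Den \<subseteq> carrier A" by (auto simp: Den_eq carrier_A)
  show "\<one>\<^bsub>A\<^esub> \<in> Den"
    using smono_in_Den[of 1 0 0 0] by (simp add: cls_simps smono_def)
next
  fix s t assume "s \<in> Den" "t \<in> Den"
  then obtain c i j k c' i' j' k' where st: "s = cls (smono c i j k)" "t = cls (smono c' i' j' k')"
    "c \<noteq> 0" "c' \<noteq> 0"
    unfolding Den_eq by blast
  have "s \<otimes>\<^bsub>A\<^esub> t = cls (smono (c * c' * inverse q ^ (k * j')) (i + i') (j + j') (k + k'))"
    unfolding st(1,2) cls_simps cls_eq_iff by (rule smono_mult)
  moreover have "c * c' * inverse q ^ (k * j') \<noteq> 0" using st nz by simp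
  ultimately show "s \<otimes>\<^bsub>A\<^esub> t \<in> Den" unfolding Den_eq by blast
next
  fix a s assume "a \<in> carrier A" "s \<in> Den"
  then obtain f c i j k where a: "a = cls f" "s = cls (smono c i j k)" "c \<noteq> 0"
    unfolding Den_eq carrier_A by blast
  have "s \<otimes>\<^bsub>A\<^esub> a = cls (twist (wt i j k) f) \<otimes>\<^bsub>A\<^esub> s"
    unfolding a(1,2) cls_simps cls_eq_iff by (rule normal_twist[OF normal_smono])
  thus "\<exists>u\<in>Den. \<exists>c\<in>carrier A. u \<otimes>\<^bsub>A\<^esub> a = c \<otimes>\<^bsub>A\<^esub> s"
    using \<open>s \<in> Den\<close> unfolding carrier_A by blast
  assume "a \<otimes>\<^bsub>A\<^esub> s = \<zero>\<^bsub>A\<^esub>"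
  hence "f * smono c i j k \<in> W"
    unfolding a(1,2) cls_simps cls_eq_iff cong_zero_iff .
  hence "s \<otimes>\<^bsub>A\<^esub> a = \<zero>\<^bsub>A\<^esub>"
    unfolding a(1,2) cls_simps cls_eq_iff cong_zero_iff by (rule smono_reversible)
  thus "\<exists>u\<in>Den. u \<otimes>\<^bsub>A\<^esub> a = \<zero>\<^bsub>A\<^esub>" using \<open>s \<in> Den\<close> by blast
qed

sublocale L: left_denominator_set A Den
  by (rule left_denominator_set_Den)

lemma zero_notin_Den: "\<zero>\<^bsub>A\<^esub> \<notin> Den"
proof
  assume "\<zero>\<^bsub>A\<^esub> \<in> Den"
  then obtain c i j k where "c \<noteq> 0" "cls 0 = cls (smono c i j k)"
    unfolding Den_eq cls_simps by blast
  hence "c \<noteq> 0" "smono c i j k \<in> W" by (metis cls_eq_iff cong_zero_iff cong_sym)+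
  thus False using smono_notin_W by blast
qed

text \<open>The canonical map from the free algebra to the localization; its restriction to the scalars is
  the algebra structure.\<close>

definition emb :: "(gen, 'k) free_algebra \<Rightarrow> ((gen, 'k) free_algebra set \<times> (gen, 'k) free_algebra set) set" where
  "emb f = L.fraction \<one>\<^bsub>A\<^esub> (cls f)"

lemma emb_closed: "emb f \<in> carrier L.Loc"
  unfolding emb_def using L.one_in by (intro L.frac_closed) (auto simp: carrier_A)

lemma emb_hom:
  "emb (f * g) = emb f \<otimes>\<^bsub>L.Loc\<^esub> emb g" "emb (f + g) = emb f \<oplus>\<^bsub>L.Loc\<^esub> emb g"
  "emb 1 = \<one>\<^bsub>L.Loc\<^esub>" "emb 0 = \<zero>\<^bsub>L.Loc\<^esub>"
  using ring_hom_mult[OF L.frac_one_hom, of "cls f" "cls g"] ring_hom_add[OF L.frac_one_hom, of "cls f" "cls g"]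
  by (simp_all add: emb_def cls_simps carrier_A L.one_Loc L.zero_Loc)

lemma emb_scal_central:
  assumes "P \<in> carrier L.Loc"
  shows "emb (scal c) \<otimes>\<^bsub>L.Loc\<^esub> P = P \<otimes>\<^bsub>L.Loc\<^esub> emb (scal c)"
proof -
  obtain s a where P: "P = L.fraction s a" "s \<in> Den" "a \<in> carrier A"
    using assms unfolding L.carrier_Loc by blast
  have central: "b \<otimes>\<^bsub>A\<^esub> cls (scal c) = cls (scal c) \<otimes>\<^bsub>A\<^esub> b" if "b \<in> carrier A" for b
    using that by (auto simp: carrier_A cls_simps scal_comm)
  have sc: "s \<in> carrier A" "cls (scal c) \<in> carrier A" using P(2) L.sub by (auto simp: carrier_A)
  have "emb (scal c) \<otimes>\<^bsub>L.Loc\<^esub> P = L.fraction (s \<otimes>\<^bsub>A\<^esub> \<one>\<^bsub>A\<^esub>) (cls (scal c) \<otimes>\<^bsub>A\<^esub> a)"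
    unfolding emb_def P(1) using P(2,3) sc L.one_in
    by (intro L.frac_mult) (simp_all add: central)
  also have "\<dots> = L.fraction (\<one>\<^bsub>A\<^esub> \<otimes>\<^bsub>A\<^esub> s) (a \<otimes>\<^bsub>A\<^esub> cls (scal c))"
    using P(3) sc by (simp add: central)
  also have "\<dots> = P \<otimes>\<^bsub>L.Loc\<^esub> emb (scal c)"
    unfolding emb_def P(1) using P(2,3) sc L.one_in
    by (intro L.frac_mult[symmetric]) simp_all
  finally show ?thesis .
qed

lemma emb_inverse:
  assumes "\<sigma> \<in> {Fz, Fs, Ft}"
  obtains \<tau> where "\<tau> \<in> carrier L.Loc" "\<tau> \<otimes>\<^bsub>L.Loc\<^esub> emb \<sigma> = \<one>\<^bsub>L.Loc\<^esub>" "emb \<sigma> \<otimes>\<^bsub>L.Loc\<^esub> \<tau> = \<one>\<^bsub>L.Loc\<^esub>"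
proof -
  have "cls \<sigma> \<in> Den"
    using assms smono_in_Den[of 1 1 0 0] smono_in_Den[of 1 0 1 0] smono_in_Den[of 1 0 0 1]
    by (auto simp: smono_def)
  from L.frac_inverse[OF this] L.frac_closed[OF this L.one_closed] show thesis
    using that unfolding emb_def by blast
qed

text \<open>A nonzero fraction in the ideal yields, after multiplication by its denominator, an element of the
  algebra that is not zero, so the preimage of the ideal contains \<open>1\<close>.\<close>

lemma localization_ideals:
  assumes "\<not> root_of_unity p" "\<not> root_of_unity q"
    and "ideal I L.Loc" "I \<noteq> {\<zero>\<^bsub>L.Loc\<^esub>}"
  shows "I = carrier L.Loc"
proof -
  interpret I: ideal I L.Loc by fact
  define J where "J = {f. emb f \<in> I}"
  interpret J: saturated_ideal p q lam mu J
  proof unfold_locales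
    show "W \<subseteq> J"
    proof
      fix f assume "f \<in> W"
      hence "cls f = cls 0" by (simp add: cls_eq_iff cong_zero_iff)
      hence "emb f = emb 0" by (simp add: emb_def)
      thus "f \<in> J" by (simp add: J_def emb_hom)
    qed
    fix \<sigma> f :: "(gen, 'k) free_algebra" assume \<sigma>: "\<sigma> \<in> {Fz, Fs, Ft}"
    obtain \<tau> where \<tau>: "\<tau> \<in> carrier L.Loc" "\<tau> \<otimes>\<^bsub>L.Loc\<^esub> emb \<sigma> = \<one>\<^bsub>L.Loc\<^esub>" "emb \<sigma> \<otimes>\<^bsub>L.Loc\<^esub> \<tau> = \<one>\<^bsub>L.Loc\<^esub>"
      using emb_inverse[OF \<sigma>] .
    show "f \<in> J" if "\<sigma> * f \<in> J"
    proof -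
      have "\<tau> \<otimes>\<^bsub>L.Loc\<^esub> (emb \<sigma> \<otimes>\<^bsub>L.Loc\<^esub> emb f) \<in> I"
        by (rule I.I_l_closed[OF _ \<tau>(1)]) (use that in \<open>simp add: J_def emb_hom\<close>)
      thus ?thesis using \<tau> by (simp add: I.m_assoc[symmetric] emb_closed J_def)
    qed
    show "f \<in> J" if "f * \<sigma> \<in> J"
    proof -
      have "(emb f \<otimes>\<^bsub>L.Loc\<^esub> emb \<sigma>) \<otimes>\<^bsub>L.Loc\<^esub> \<tau> \<in> I"
        by (rule I.I_r_closed[OF _ \<tau>(1)]) (use that in \<open>simp add: J_def emb_hom\<close>)
      thus ?thesis using \<tau> by (simp add: I.m_assoc emb_closed J_def)
    qed
  next
    fix f g assume "f \<in> J" "g \<in> J"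
    thus "f + g \<in> J" unfolding J_def mem_Collect_eq emb_hom
      by (rule additive_subgroup.a_closed[OF I.additive_subgroup_axioms])
  next
    fix f h assume "f \<in> J"
    hence f: "emb f \<in> I" by (simp add: J_def)
    show "h * f \<in> J"
      unfolding J_def mem_Collect_eq emb_hom by (rule I.I_l_closed[OF f emb_closed])
    show "f * h \<in> J"
      unfolding J_def mem_Collect_eq emb_hom by (rule I.I_r_closed[OF f emb_closed])
  qed (rule assms(1), rule assms(2))
  obtain P where P: "P \<in> I" "P \<noteq> \<zero>\<^bsub>L.Loc\<^esub>"
    using assms(4) additive_subgroup.zero_closed[OF I.additive_subgroup_axioms] by blast
  obtain s f where s: "P = L.fraction s (cls f)" "s \<in> Den"
    using I.Icarr[OF P(1)] unfolding L.carrier_Loc carrier_A by blast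
  have cf: "cls f \<in> carrier A" by (simp add: carrier_A)
  have "f \<notin> W"
  proof
    assume "f \<in> W"
    hence "cls f = \<zero>\<^bsub>A\<^esub>" by (simp add: cls_simps cls_eq_iff cong_zero_iff)
    thus False using P(2) s L.frac_zero by simp
  qed
  have "emb f = L.fraction \<one>\<^bsub>A\<^esub> s \<otimes>\<^bsub>L.Loc\<^esub> P"
    unfolding s(1) emb_def using L.frac_mult_chain[OF L.one_in s(2) L.one_closed cf]
      L.in_carrier[OF s(2)] cf by simp
  hence "f \<in> J"
    using I.I_l_closed[OF P(1), of "L.fraction \<one>\<^bsub>A\<^esub> s"] L.one_in L.in_carrier[OF s(2)]
    by (simp add: J_def)
  hence "emb 1 \<in> I" using J.saturated_ideal_trivial \<open>f \<notin> W\<close> unfolding J_def by blast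
  thus ?thesis using I.one_imp_carrier by (simp add: emb_hom)
qed

end

theorem theorem1p1:
  fixes p q lam mu :: "'k::field"
  assumes "p \<noteq> 0" and "q \<noteq> 0" and "lam \<noteq> 0" and "mu \<noteq> 0"
    and "\<not> root_of_unity p" and "\<not> root_of_unity q"
  shows "simple_algebra (weyl_localization_scal p q lam mu) (weyl_localization p q lam mu)"
proof -
  interpret quantum_weyl p q lam mu by unfold_locales (use assms in auto)
  have Loc: "weyl_localization p q lam mu = L.Loc" by (simp add: weyl_localization_def)
  have scal: "weyl_localization_scal p q lam mu = (\<lambda>c. emb (scal c))"
    by (simp add: fun_eq_iff weyl_localization_scal_def emb_def)
  have "(\<lambda>c. emb (scal c)) \<in> ring_hom (ring_of_type_algebra :: 'k ring) L.Loc"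
    by (rule ring_hom_memI)
      (simp_all add: ring_of_type_algebra_def emb_closed scal_mult scal_add emb_hom)
  thus ?thesis
    unfolding Loc scal simple_algebra_def assoc_algebra_def
    using L.ring_Loc emb_scal_central L.one_neq_zero_Loc[OF zero_notin_Den]
      localization_ideals[OF assms(5,6)] by blast
qed

end
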